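(* Let $\mathbb{E}$ be a regular category. Suppose that any chain of reflexive relations in $\mathbb{E}$ admits a supremum (among the reflexive relations on the same object) and that these suprema are stable under composition of reflexive relations. Then, for any pair $(R,S)$ of reflexive relations on an object $X$, the supremum $\Sigma((R,S))$ of the chain $((R,S))$ is a preorder. Accordingly, when, moreover, $R$ and $S$ are symmetric, $\Sigma((R,S))$ is an equivalence relation.
   Context: A relation on $X$ is (a class up to isomorphism of) a subobject $R\rightarrowtail X\times X$, ordered by inclusion. In a regular category relations compose: $SR=S\circ R$ is the usual composite relation ($x(SR)z$ iff there is $y$ with $xRy$ and $ySz$), defined by a pullback followed by the regular epi–mono factorization. $R$ is reflexive if $\Delta_X\subset R$, symmetric if $R^{op}\subset R$, transitive if $R\circ R\subset R$; a preorder is a reflexive transitive relation, an equivalence relation is a symmetric preorder. A chain of reflexive relations on $X$ is an increasing sequence $(R_i)_{i\in\mathbb{N}}$ of reflexive relations on $X$; $\Sigma_{i\in\mathbb{N}}R_i$ denotes its supremum in the ordered set of reflexive relations on $X$. These suprema are stable under composition of reflexive relations when $\Sigma_{i\in\mathbb{N}}(R_iT)=(\Sigma_{i\in\mathbb{N}}R_i)T$ for every such chain and every reflexive relation $T$ on $X$. For reflexive relations $R,S$ on $X$, the chain $((R,S))$ is $\Delta_X\subset R\subset RS\subset RSR\subset RSRS\subset\cdots$, whose terms are denoted $(R,S)_0=\Delta_X$, $(R,S)_1=R$, $(R,S)_2=RS$, $(R,S)_3=RSR$, etc. (alternating product of $n$ factors beginning with $R$), and $\Sigma((R,S))=\Sigma_{n\in\mathbb{N}}(R,S)_n$.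 *)

theory Defs
  imports "HOL-Algebra.Lattice"
begin

section \<open>Regular categories\<close>

record ('o, 'm) category =
  Obj :: "'o set"
  Arr :: "'m set"
  Dom :: "'m \<Rightarrow> 'o"
  Cod :: "'m \<Rightarrow> 'o"
  Id :: "'o \<Rightarrow> 'm"
  Comp :: "'m \<Rightarrow> 'm \<Rightarrow> 'm" (infixl "\<cdot>\<index>" 70)

definition arrows :: "('o, 'm) category \<Rightarrow> 'o \<Rightarrow> 'o \<Rightarrow> 'm set" where
  "arrows C X Y = {f \<in> Arr C. Dom C f = X \<and> Cod C f = Y}"

text \<open>\<open>g \<cdot> f\<close> is \<open>f\<close> followed by \<open>g\<close>, unspecified unless \<open>Cod f = Dom g\<close>.\<close>

locale category =
  fixes C :: "('o, 'm) category" (structure)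
  assumes Dom_in_Obj: "f \<in> Arr C \<Longrightarrow> Dom C f \<in> Obj C"
    and Cod_in_Obj: "f \<in> Arr C \<Longrightarrow> Cod C f \<in> Obj C"
    and Id_in_arrows: "X \<in> Obj C \<Longrightarrow> Id C X \<in> arrows C X X"
    and Comp_in_arrows: "\<lbrakk>f \<in> arrows C X Y; g \<in> arrows C Y Z\<rbrakk> \<Longrightarrow> g \<cdot> f \<in> arrows C X Z"
    and Comp_assoc:
      "\<lbrakk>f \<in> arrows C W X; g \<in> arrows C X Y; h \<in> arrows C Y Z\<rbrakk> \<Longrightarrow> (h \<cdot> g) \<cdot> f = h \<cdot> (g \<cdot> f)"
    and Comp_Id_left: "f \<in> arrows C X Y \<Longrightarrow> Id C Y \<cdot> f = f"
    and Comp_Id_right: "f \<in> arrows C X Y \<Longrightarrow> f \<cdot> Id C X = f"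

definition monic :: "('o, 'm) category \<Rightarrow> 'm \<Rightarrow> bool" where
  "monic C m \<longleftrightarrow> m \<in> Arr C \<and>
    (\<forall>A. \<forall>f\<in>arrows C A (Dom C m). \<forall>g\<in>arrows C A (Dom C m). m \<cdot>\<^bsub>C\<^esub> f = m \<cdot>\<^bsub>C\<^esub> g \<longrightarrow> f = g)"

definition isomorphism :: "('o, 'm) category \<Rightarrow> 'm \<Rightarrow> bool" where
  "isomorphism C f \<longleftrightarrow> f \<in> Arr C \<and>
    (\<exists>g\<in>arrows C (Cod C f) (Dom C f). g \<cdot>\<^bsub>C\<^esub> f = Id C (Dom C f) \<and> f \<cdot>\<^bsub>C\<^esub> g = Id C (Cod C f))"

definition is_coequalizer :: "('o, 'm) category \<Rightarrow> 'm \<Rightarrow> 'm \<Rightarrow> 'm \<Rightarrow> bool" where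
  "is_coequalizer C f g q \<longleftrightarrow>
    f \<in> Arr C \<and> g \<in> arrows C (Dom C f) (Cod C f) \<and>
    q \<in> Arr C \<and> Dom C q = Cod C f \<and> q \<cdot>\<^bsub>C\<^esub> f = q \<cdot>\<^bsub>C\<^esub> g \<and>
    (\<forall>Z. \<forall>k\<in>arrows C (Cod C f) Z. k \<cdot>\<^bsub>C\<^esub> f = k \<cdot>\<^bsub>C\<^esub> g \<longrightarrow>
      (\<exists>!h. h \<in> arrows C (Cod C q) Z \<and> h \<cdot>\<^bsub>C\<^esub> q = k))"

definition regular_epi :: "('o, 'm) category \<Rightarrow> 'm \<Rightarrow> bool" where
  "regular_epi C q \<longleftrightarrow> (\<exists>f g. is_coequalizer C f g q)"

definition is_pullback :: "('o, 'm) category \<Rightarrow> 'm \<Rightarrow> 'm \<Rightarrow> 'm \<Rightarrow> 'm \<Rightarrow> bool" where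
  "is_pullback C f g p q \<longleftrightarrow>
    f \<in> Arr C \<and> g \<in> Arr C \<and> Cod C f = Cod C g \<and>
    p \<in> Arr C \<and> Cod C p = Dom C f \<and> q \<in> arrows C (Dom C p) (Dom C g) \<and>
    f \<cdot>\<^bsub>C\<^esub> p = g \<cdot>\<^bsub>C\<^esub> q \<and>
    (\<forall>A. \<forall>u\<in>arrows C A (Dom C f). \<forall>v\<in>arrows C A (Dom C g). f \<cdot>\<^bsub>C\<^esub> u = g \<cdot>\<^bsub>C\<^esub> v \<longrightarrow>
      (\<exists>!h. h \<in> arrows C A (Dom C p) \<and> p \<cdot>\<^bsub>C\<^esub> h = u \<and> q \<cdot>\<^bsub>C\<^esub> h = v))"

definition is_product :: "('o, 'm) category \<Rightarrow> 'o \<Rightarrow> 'o \<Rightarrow> 'o \<times> 'm \<times> 'm \<Rightarrow> bool" where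
  "is_product C X Y = (\<lambda>(P, p, q).
    p \<in> arrows C P X \<and> q \<in> arrows C P Y \<and>
    (\<forall>A. \<forall>u\<in>arrows C A X. \<forall>v\<in>arrows C A Y.
      (\<exists>!h. h \<in> arrows C A P \<and> p \<cdot>\<^bsub>C\<^esub> h = u \<and> q \<cdot>\<^bsub>C\<^esub> h = v)))"

text \<open>A finite diagram is given by the list \<open>xs\<close> of the objects at its vertices \<open>0, \<dots>, length xs - 1\<close>
  and a finite set \<open>E\<close> of labelled edges, \<open>(i, j, f)\<close> being an edge \<open>f\<close> from vertex \<open>i\<close> to vertex \<open>j\<close>.\<close>

definition is_diagram :: "('o, 'm) category \<Rightarrow> 'o list \<Rightarrow> (nat \<times> nat \<times> 'm) set \<Rightarrow> bool" where
  "is_diagram C xs E \<longleftrightarrow> set xs \<subseteq> Obj C \<and> finite E \<and>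
    (\<forall>(i, j, f)\<in>E. i < length xs \<and> j < length xs \<and> f \<in> arrows C (xs ! i) (xs ! j))"

definition is_cone ::
    "('o, 'm) category \<Rightarrow> 'o list \<Rightarrow> (nat \<times> nat \<times> 'm) set \<Rightarrow> 'o \<Rightarrow> 'm list \<Rightarrow> bool" where
  "is_cone C xs E A ps \<longleftrightarrow> A \<in> Obj C \<and> length ps = length xs \<and>
    (\<forall>i < length xs. ps ! i \<in> arrows C A (xs ! i)) \<and>
    (\<forall>(i, j, f)\<in>E. f \<cdot>\<^bsub>C\<^esub> (ps ! i) = ps ! j)"

definition is_limit ::
    "('o, 'm) category \<Rightarrow> 'o list \<Rightarrow> (nat \<times> nat \<times> 'm) set \<Rightarrow> 'o \<Rightarrow> 'm list \<Rightarrow> bool" where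
  "is_limit C xs E L ps \<longleftrightarrow> is_cone C xs E L ps \<and>
    (\<forall>A qs. is_cone C xs E A qs \<longrightarrow>
      (\<exists>!h. h \<in> arrows C A L \<and> (\<forall>i < length xs. (ps ! i) \<cdot>\<^bsub>C\<^esub> h = qs ! i)))"

locale regular_category = category +
  assumes finite_limits: "is_diagram C xs E \<Longrightarrow> \<exists>L ps. is_limit C xs E L ps"
    and kernel_pair_coequalizer: "is_pullback C f f p q \<Longrightarrow> \<exists>e. is_coequalizer C p q e"
    and regular_epi_stable: "\<lbrakk>regular_epi C e; is_pullback C e g p q\<rbrakk> \<Longrightarrow> regular_epi C q"


section \<open>Relations\<close>

definition subobject_equiv :: "('o, 'm) category \<Rightarrow> 'o \<Rightarrow> ('m \<times> 'm) set" where
  "subobject_equiv C P = {(m, n). monic C m \<and> Cod C m = P \<and> monic C n \<and> Cod C n = P \<and>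
    (\<exists>h\<in>arrows C (Dom C m) (Dom C n). isomorphism C h \<and> n \<cdot>\<^bsub>C\<^esub> h = m)}"

definition subobjects :: "('o, 'm) category \<Rightarrow> 'o \<Rightarrow> 'm set set" where
  "subobjects C P = {m. monic C m \<and> Cod C m = P} // subobject_equiv C P"

definition subobject_le :: "('o, 'm) category \<Rightarrow> 'm set \<Rightarrow> 'm set \<Rightarrow> bool" where
  "subobject_le C R S \<longleftrightarrow>
    (\<exists>r\<in>R. \<exists>s\<in>S. \<exists>h\<in>arrows C (Dom C r) (Dom C s). s \<cdot>\<^bsub>C\<^esub> h = r)"

definition square :: "('o, 'm) category \<Rightarrow> 'o \<Rightarrow> 'o \<times> 'm \<times> 'm" where
  "square C X = (SOME P. is_product C X X P)"

definition sq :: "('o, 'm) category \<Rightarrow> 'o \<Rightarrow> 'o" where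
  "sq C X = fst (square C X)"

definition pr1 :: "('o, 'm) category \<Rightarrow> 'o \<Rightarrow> 'm" where
  "pr1 C X = fst (snd (square C X))"

definition pr2 :: "('o, 'm) category \<Rightarrow> 'o \<Rightarrow> 'm" where
  "pr2 C X = snd (snd (square C X))"

definition pairing :: "('o, 'm) category \<Rightarrow> 'o \<Rightarrow> 'm \<Rightarrow> 'm \<Rightarrow> 'm" where
  "pairing C X f g =
    (THE h. h \<in> arrows C (Dom C f) (sq C X) \<and> pr1 C X \<cdot>\<^bsub>C\<^esub> h = f \<and> pr2 C X \<cdot>\<^bsub>C\<^esub> h = g)"

definition relations :: "('o, 'm) category \<Rightarrow> 'o \<Rightarrow> 'm set set" where
  "relations C X = subobjects C (sq C X)"

definition rel_diag :: "('o, 'm) category \<Rightarrow> 'o \<Rightarrow> 'm set" where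
  "rel_diag C X = subobject_equiv C (sq C X) `` {pairing C X (Id C X) (Id C X)}"

definition rel_op :: "('o, 'm) category \<Rightarrow> 'o \<Rightarrow> 'm set \<Rightarrow> 'm set" where
  "rel_op C X R = (\<lambda>r. pairing C X (pr2 C X \<cdot>\<^bsub>C\<^esub> r) (pr1 C X \<cdot>\<^bsub>C\<^esub> r)) ` R"

text \<open>\<open>rel_comp C X S R\<close> is \<open>SR = S \<circ> R\<close>, \<open>R\<close> followed by \<open>S\<close>. It consists of all the monic parts
  \<open>m\<close> of regular epi-mono factorizations \<open>m \<cdot> e\<close> of the arrow to \<open>X \<times> X\<close> induced by a pullback of
  the second leg of \<open>R\<close> along the first leg of \<open>S\<close>. In a regular category these \<open>m\<close> form exactly one
  isomorphism class.\<close>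

definition rel_comp :: "('o, 'm) category \<Rightarrow> 'o \<Rightarrow> 'm set \<Rightarrow> 'm set \<Rightarrow> 'm set" where
  "rel_comp C X S R = {m. monic C m \<and> Cod C m = sq C X \<and>
    (\<exists>r\<in>R. \<exists>s\<in>S. \<exists>u v e.
      is_pullback C (pr2 C X \<cdot>\<^bsub>C\<^esub> r) (pr1 C X \<cdot>\<^bsub>C\<^esub> s) u v \<and>
      regular_epi C e \<and> e \<in> arrows C (Dom C u) (Dom C m) \<and>
      m \<cdot>\<^bsub>C\<^esub> e = pairing C X (pr1 C X \<cdot>\<^bsub>C\<^esub> r \<cdot>\<^bsub>C\<^esub> u) (pr2 C X \<cdot>\<^bsub>C\<^esub> s \<cdot>\<^bsub>C\<^esub> v))}"

definition reflexive_rel :: "('o, 'm) category \<Rightarrow> 'o \<Rightarrow> 'm set \<Rightarrow> bool" where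
  "reflexive_rel C X R \<longleftrightarrow> R \<in> relations C X \<and> subobject_le C (rel_diag C X) R"

definition symmetric_rel :: "('o, 'm) category \<Rightarrow> 'o \<Rightarrow> 'm set \<Rightarrow> bool" where
  "symmetric_rel C X R \<longleftrightarrow> R \<in> relations C X \<and> subobject_le C (rel_op C X R) R"

definition transitive_rel :: "('o, 'm) category \<Rightarrow> 'o \<Rightarrow> 'm set \<Rightarrow> bool" where
  "transitive_rel C X R \<longleftrightarrow> R \<in> relations C X \<and> subobject_le C (rel_comp C X R R) R"

definition preorder_rel :: "('o, 'm) category \<Rightarrow> 'o \<Rightarrow> 'm set \<Rightarrow> bool" where
  "preorder_rel C X R \<longleftrightarrow> reflexive_rel C X R \<and> transitive_rel C X R"

definition equivalence_rel :: "('o, 'm) category \<Rightarrow> 'o \<Rightarrow> 'm set \<Rightarrow> bool" where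
  "equivalence_rel C X R \<longleftrightarrow> symmetric_rel C X R \<and> preorder_rel C X R"


section \<open>Chains of reflexive relations\<close>

definition reflexive_order :: "('o, 'm) category \<Rightarrow> 'o \<Rightarrow> 'm set gorder" where
  "reflexive_order C X =
    \<lparr>carrier = {R. reflexive_rel C X R}, eq = (=), le = subobject_le C\<rparr>"

definition reflexive_chain :: "('o, 'm) category \<Rightarrow> 'o \<Rightarrow> (nat \<Rightarrow> 'm set) \<Rightarrow> bool" where
  "reflexive_chain C X R \<longleftrightarrow>
    (\<forall>i. reflexive_rel C X (R i)) \<and> (\<forall>i. subobject_le C (R i) (R (Suc i)))"

text \<open>\<open>\<Squnion>\<close> is a choice operator, meaningful only when the least upper bound exists. It exists for
  every chain under \<open>has_chain_sups\<close> below.\<close>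

definition chain_sup :: "('o, 'm) category \<Rightarrow> 'o \<Rightarrow> (nat \<Rightarrow> 'm set) \<Rightarrow> 'm set" where
  "chain_sup C X R = \<Squnion>\<^bsub>reflexive_order C X\<^esub> (range R)"

definition has_chain_sups :: "('o, 'm) category \<Rightarrow> bool" where
  "has_chain_sups C \<longleftrightarrow> (\<forall>X\<in>Obj C. \<forall>R. reflexive_chain C X R \<longrightarrow>
    (\<exists>S. least (reflexive_order C X) S (Upper (reflexive_order C X) (range R))))"

definition chain_sups_stable :: "('o, 'm) category \<Rightarrow> bool" where
  "chain_sups_stable C \<longleftrightarrow>
    (\<forall>X\<in>Obj C. \<forall>R T. reflexive_chain C X R \<and> reflexive_rel C X T \<longrightarrow>
      chain_sup C X (\<lambda>i. rel_comp C X (R i) T) = rel_comp C X (chain_sup C X R) T)"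

text \<open>\<open>alternating C X R S n\<close> is \<open>(R, S)\<^sub>n\<close>: the products \<open>\<Delta>, R, RS, RSR, \<dots>\<close>, bracketed to the left.\<close>

fun alternating :: "('o, 'm) category \<Rightarrow> 'o \<Rightarrow> 'm set \<Rightarrow> 'm set \<Rightarrow> nat \<Rightarrow> 'm set" where
  "alternating C X R S 0 = rel_diag C X"
| "alternating C X R S (Suc 0) = R"
| "alternating C X R S (Suc (Suc n)) =
    rel_comp C X (alternating C X R S (Suc n)) (if even n then S else R)"

end

theory Submission
  imports Defs
begin

text \<open>Write \<open>A\<^sub>n = (R, S)\<^sub>n\<close> and \<open>W\<close> for the supremum of the chain of the \<open>A\<^sub>n\<close>. If relations were
  sets of pairs, \<open>W\<close> would be the union of the \<open>A\<^sub>n\<close>, and transitivity would follow from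
  \<open>A\<^sub>n A\<^sub>m \<subseteq> A\<^bsub>n+m+1\<^esub>\<close>: for even \<open>n\<close> the two products join into \<open>A\<^bsub>n+m\<^esub>\<close>, and for odd \<open>n\<close> one first
  inserts a factor \<open>S\<close> between the two adjacent factors \<open>R\<close> (\<open>alternating_comp_le\<close>).
  In general, stability of suprema gives \<open>W W = \<Sigma>\<^sub>n A\<^sub>n W\<close>, and each \<open>A\<^sub>n W\<close> is \<open>\<Sigma>\<^sub>m A\<^sub>n A\<^sub>m\<close>, so that
  \<open>W W \<subseteq> W\<close>. The second equality needs stability on the other side; it is reduced to the
  assumed one by passing to opposite relations, which preserves order and hence suprema but
  reverses composites (\<open>chain_sup_comp_left_le\<close>).

  If \<open>R\<close> and \<open>S\<close> are symmetric, the opposite of \<open>A\<^sub>n\<close> is a product of \<open>R\<close>s and \<open>S\<close>s in the reverse order.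
  Both \<open>R\<close> and \<open>S\<close> lie below the transitive \<open>W\<close>, so this product does as well. Thus every \<open>A\<^sub>n\<close>,
  and with them \<open>W\<close>, lies below the opposite of \<open>W\<close>.

  These arguments need the calculus of relations in a regular category: composites are again
  relations, are monotone, can be rebracketed, and are reversed by passing to opposites. It is
  obtained with generalized elements. A pair of arrows \<open>A \<rightarrow> X\<close> either belongs to a relation or not
  (\<open>related\<close>), inclusion of relations is inclusion of such pairs (\<open>subobject_le_iff_related\<close>), and a
  pair belongs to a composite exactly when, after restriction along some regular epimorphism,
  it has an intermediate element (\<open>related_rel_comp\<close>). Since membership may be checked after
  restriction along a regular epimorphism (\<open>related_local\<close>), every inclusion between composites can be proved
  as for relations between sets (\<open>rel_comp_leI\<close>).\<close>

section \<open>Arrows\<close>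

context category
begin

lemma Arr_Comp:
  assumes "f \<in> Arr C" "g \<in> Arr C" "Dom C g = Cod C f"
  shows "g \<cdot> f \<in> Arr C" "Dom C (g \<cdot> f) = Dom C f" "Cod C (g \<cdot> f) = Cod C g"
  using Comp_in_arrows[of f "Dom C f" "Cod C f" g "Cod C g"] assms by (auto simp: arrows_def)

lemma Arr_assoc:
  assumes "f \<in> Arr C" "g \<in> Arr C" "h \<in> Arr C" "Dom C g = Cod C f" "Dom C h = Cod C g"
  shows "(h \<cdot> g) \<cdot> f = h \<cdot> (g \<cdot> f)"
  by (rule Comp_assoc) (use assms in \<open>auto simp: arrows_def\<close>)

lemma Arr_Id:
  assumes "A \<in> Obj C"
  shows "Id C A \<in> Arr C" "Dom C (Id C A) = A" "Cod C (Id C A) = A"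
  using Id_in_arrows[OF assms] by (auto simp: arrows_def)

lemma Id_neutral:
  assumes "f \<in> Arr C"
  shows "Id C (Cod C f) \<cdot> f = f" "f \<cdot> Id C (Dom C f) = f"
  using assms Comp_Id_left[of f] Comp_Id_right[of f] by (auto simp: arrows_def)

lemmas arrow_simps = arrows_def Arr_Comp Arr_assoc Arr_Id Id_neutral Dom_in_Obj Cod_in_Obj

lemma monicD:
  assumes "monic C m" "f \<in> arrows C A (Dom C m)" "g \<in> arrows C A (Dom C m)" "m \<cdot> f = m \<cdot> g"
  shows "f = g"
  using assms unfolding monic_def by blast

lemma monic_Arr: "monic C m \<Longrightarrow> m \<in> Arr C"
  by (simp add: monic_def)

lemma coequalizer_factor:
  assumes "is_coequalizer C f g q" "k \<in> arrows C (Cod C f) Z" "k \<cdot> f = k \<cdot> g"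
  shows "\<exists>!h. h \<in> arrows C (Cod C q) Z \<and> h \<cdot> q = k"
  using assms unfolding is_coequalizer_def by blast

lemma pullback_factor:
  assumes "is_pullback C f g p q" "u \<in> arrows C A (Dom C f)" "v \<in> arrows C A (Dom C g)"
    "f \<cdot> u = g \<cdot> v"
  shows "\<exists>!h. h \<in> arrows C A (Dom C p) \<and> p \<cdot> h = u \<and> q \<cdot> h = v"
  using assms unfolding is_pullback_def by blast

lemma regular_epi_cancel:
  assumes e: "regular_epi C e" and ab: "a \<in> arrows C (Cod C e) Z" "b \<in> arrows C (Cod C e) Z"
    and eq: "a \<cdot> e = b \<cdot> e"
  shows "a = b"
proof -
  obtain f g where fg: "is_coequalizer C f g e"
    using e by (auto simp: regular_epi_def)
  then have ar: "f \<in> Arr C" "g \<in> Arr C" "e \<in> Arr C" "Cod C g = Cod C f" "Dom C e = Cod C f"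
    and ef: "e \<cdot> f = e \<cdot> g"
    by (auto simp: is_coequalizer_def arrows_def)
  have "a \<cdot> e \<in> arrows C (Cod C f) Z"
    using ab ar by (simp add: arrow_simps)
  moreover have "(a \<cdot> e) \<cdot> f = (a \<cdot> e) \<cdot> g"
    using ab ar ef by (simp add: arrow_simps)
  ultimately have "\<exists>!h. h \<in> arrows C (Cod C e) Z \<and> h \<cdot> e = a \<cdot> e"
    by (rule coequalizer_factor[OF fg])
  then show ?thesis using ab eq by metis
qed

text \<open>Regular epimorphisms are orthogonal to monomorphisms: a coequalizer of \<open>f\<close> and \<open>g\<close> equalizes
  them after any mono, hence already before it.\<close>

lemma regular_epi_diagonal:
  assumes e: "regular_epi C e" "e \<in> arrows C A B" and m: "monic C m"
    and u: "u \<in> arrows C A (Dom C m)" and v: "v \<in> arrows C B (Cod C m)" and eq: "m \<cdot> u = v \<cdot> e"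
  obtains h where "h \<in> arrows C B (Dom C m)" "m \<cdot> h = v" "h \<cdot> e = u"
proof -
  obtain f g where fg: "is_coequalizer C f g e"
    using e by (auto simp: regular_epi_def)
  then have ar: "f \<in> Arr C" "g \<in> Arr C" "Cod C f = A" "Cod C g = A" "Dom C g = Dom C f"
    and ef: "e \<cdot> f = e \<cdot> g"
    using e by (auto simp: is_coequalizer_def arrows_def)
  note mA = monic_Arr[OF m]
  have "m \<cdot> (u \<cdot> f) = (v \<cdot> e) \<cdot> f"
    using ar u mA by (simp add: arrow_simps flip: eq)
  also have "\<dots> = (v \<cdot> e) \<cdot> g"
    using ar e v ef by (simp add: arrow_simps)
  also have "\<dots> = m \<cdot> (u \<cdot> g)"
    using ar u mA by (simp add: arrow_simps flip: eq)
  finally have *: "m \<cdot> (u \<cdot> f) = m \<cdot> (u \<cdot> g)" .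
  have "u \<cdot> f = u \<cdot> g"
    by (rule monicD[OF m, of _ "Dom C f"]) (use * ar u in \<open>auto simp: arrow_simps\<close>)
  moreover have "u \<in> arrows C (Cod C f) (Dom C m)" "Cod C e = B"
    using u ar(3) e(2) by (simp_all add: arrows_def)
  ultimately obtain h where h: "h \<in> arrows C B (Dom C m)" "h \<cdot> e = u"
    using coequalizer_factor[OF fg] by blast
  have **: "(m \<cdot> h) \<cdot> e = v \<cdot> e"
    using h e mA eq by (simp add: arrow_simps)
  have "m \<cdot> h = v"
    by (rule regular_epi_cancel[OF e(1), of _ "Cod C m"]) (use ** h e v mA in \<open>auto simp: arrow_simps\<close>)
  with h show thesis using that by blast
qed

lemma regular_epi_iso:
  assumes e: "regular_epi C e" and h: "isomorphism C h" "Dom C h = Cod C e"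
  shows "regular_epi C (h \<cdot> e)"
proof -
  obtain k where k: "k \<in> arrows C (Cod C h) (Dom C h)" "k \<cdot> h = Id C (Dom C h)"
      "h \<cdot> k = Id C (Cod C h)" and hA: "h \<in> Arr C"
    using h by (auto simp: isomorphism_def)
  obtain f g where fg: "is_coequalizer C f g e"
    using e by (auto simp: regular_epi_def)
  then have ar: "f \<in> Arr C" "g \<in> Arr C" "e \<in> Arr C" "Cod C g = Cod C f" "Dom C g = Dom C f"
      "Dom C e = Cod C f"
    and ef: "e \<cdot> f = e \<cdot> g"
    by (auto simp: is_coequalizer_def arrows_def)
  \<comment> \<open>\<open>h \<cdot> e\<close> coequalizes the same pair as \<open>e\<close>.\<close>
  have "\<exists>!l. l \<in> arrows C (Cod C (h \<cdot> e)) Z \<and> l \<cdot> (h \<cdot> e) = t"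
    if t: "t \<in> arrows C (Cod C f) Z" "t \<cdot> f = t \<cdot> g" for t Z
  proof -
    obtain l where l: "l \<in> arrows C (Cod C e) Z" "l \<cdot> e = t"
      using coequalizer_factor[OF fg t] by blast
    have 1: "l \<cdot> k \<in> arrows C (Cod C (h \<cdot> e)) Z"
      using l k hA h ar by (simp add: arrow_simps)
    have "(l \<cdot> k) \<cdot> (h \<cdot> e) = l \<cdot> ((k \<cdot> h) \<cdot> e)"
      using l(1) k(1) hA h ar by (simp add: arrow_simps)
    also have "\<dots> = l \<cdot> (Id C (Cod C e) \<cdot> e)"
      by (simp add: k(2) h(2))
    also have "\<dots> = t"
      using l(2) ar(3) by (simp add: Id_neutral)
    finally have 2: "(l \<cdot> k) \<cdot> (h \<cdot> e) = t" .
    have "a = b" if a: "a \<in> arrows C (Cod C (h \<cdot> e)) Z" "a \<cdot> (h \<cdot> e) = t"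
      and b: "b \<in> arrows C (Cod C (h \<cdot> e)) Z" "b \<cdot> (h \<cdot> e) = t" for a b
    proof -
      have "a \<cdot> h = b \<cdot> h"
        by (rule regular_epi_cancel[OF e, of _ Z]) (use a b hA h(2) ar in \<open>auto simp: arrow_simps\<close>)
      then have "(a \<cdot> h) \<cdot> k = (b \<cdot> h) \<cdot> k" by simp
      then have "a \<cdot> (h \<cdot> k) = b \<cdot> (h \<cdot> k)"
        using a(1) b(1) hA h ar k(1) by (simp add: arrow_simps)
      then have "a \<cdot> Id C (Cod C h) = b \<cdot> Id C (Cod C h)"
        by (simp add: k(3))
      moreover have "Dom C a = Cod C h" "Dom C b = Cod C h"
        using a(1) b(1) hA h ar by (simp_all add: arrow_simps)
      ultimately show ?thesis
        using Id_neutral(2)[of a] Id_neutral(2)[of b] a(1) b(1) unfolding arrows_def by simp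
    qed
    then show ?thesis
      using 1 2 by (metis (no_types, lifting))
  qed
  then have "is_coequalizer C f g (h \<cdot> e)"
    using hA h ar ef unfolding is_coequalizer_def by (simp add: arrow_simps)
  then show ?thesis by (auto simp: regular_epi_def)
qed

section \<open>Subobjects\<close>

text \<open>Mutual factorization already suffices: for monos the two comparison arrows are inverse to each
  other.\<close>

lemma subobject_equiv_iff:
  assumes m: "monic C m" "Cod C m = P" and n: "monic C n" "Cod C n = P"
  shows "(m, n) \<in> subobject_equiv C P \<longleftrightarrow>
    (\<exists>h\<in>arrows C (Dom C m) (Dom C n). n \<cdot> h = m) \<and> (\<exists>k\<in>arrows C (Dom C n) (Dom C m). m \<cdot> k = n)"
    (is "_ \<longleftrightarrow> ?R")
proof
  assume "(m, n) \<in> subobject_equiv C P"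
  then obtain h where h: "h \<in> arrows C (Dom C m) (Dom C n)" "isomorphism C h" "n \<cdot> h = m"
    by (auto simp: subobject_equiv_def)
  then obtain k where k: "k \<in> arrows C (Dom C n) (Dom C m)" "h \<cdot> k = Id C (Dom C n)"
    by (auto simp: isomorphism_def arrows_def)
  have "m \<cdot> k = (n \<cdot> h) \<cdot> k"
    using h(3) by simp
  also have "\<dots> = n \<cdot> (h \<cdot> k)"
    using h(1) k(1) monic_Arr[OF n(1)] by (simp add: arrow_simps)
  also have "\<dots> = n"
    using k(2) monic_Arr[OF n(1)] by (simp add: arrow_simps)
  finally show ?R using h k by blast
next
  assume ?R
  then obtain h k where h: "h \<in> arrows C (Dom C m) (Dom C n)" "n \<cdot> h = m"
    and k: "k \<in> arrows C (Dom C n) (Dom C m)" "m \<cdot> k = n" by blast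
  note mn = monic_Arr[OF m(1)] monic_Arr[OF n(1)]
  have "m \<cdot> (k \<cdot> h) = (m \<cdot> k) \<cdot> h" "n \<cdot> (h \<cdot> k) = (n \<cdot> h) \<cdot> k"
    using mn h(1) k(1) by (simp_all add: arrow_simps)
  then have "m \<cdot> (k \<cdot> h) = m \<cdot> Id C (Dom C m)" "n \<cdot> (h \<cdot> k) = n \<cdot> Id C (Dom C n)"
    using mn h(2) k(2) by (simp_all add: arrow_simps)
  moreover have "k \<cdot> h \<in> arrows C (Dom C m) (Dom C m)" "h \<cdot> k \<in> arrows C (Dom C n) (Dom C n)"
      "Id C (Dom C m) \<in> arrows C (Dom C m) (Dom C m)" "Id C (Dom C n) \<in> arrows C (Dom C n) (Dom C n)"
    using mn h(1) k(1) by (simp_all add: arrow_simps)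
  ultimately have "k \<cdot> h = Id C (Dom C m)" "h \<cdot> k = Id C (Dom C n)"
    using monicD[OF m(1)] monicD[OF n(1)] by blast+
  then have "isomorphism C h"
    using h(1) k(1) by (auto simp: isomorphism_def arrows_def)
  then show "(m, n) \<in> subobject_equiv C P"
    using m n h by (auto simp: subobject_equiv_def)
qed

lemma factor_trans:
  assumes "l \<in> Arr C" "m \<in> Arr C" "n \<in> Arr C"
    and "\<exists>h\<in>arrows C (Dom C l) (Dom C m). m \<cdot> h = l"
    and "\<exists>h\<in>arrows C (Dom C m) (Dom C n). n \<cdot> h = m"
  shows "\<exists>h\<in>arrows C (Dom C l) (Dom C n). n \<cdot> h = l"
proof -
  obtain h k where h: "h \<in> arrows C (Dom C l) (Dom C m)" "m \<cdot> h = l"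
    and k: "k \<in> arrows C (Dom C m) (Dom C n)" "n \<cdot> k = m"
    using assms by blast
  have "n \<cdot> (k \<cdot> h) = (n \<cdot> k) \<cdot> h"
    using h(1) k(1) assms(1-3) by (simp add: arrow_simps)
  then have "n \<cdot> (k \<cdot> h) = l" using h k by simp
  then show ?thesis using Comp_in_arrows[OF h(1) k(1)] by blast
qed

lemma equiv_subobject_equiv:
  "equiv {m. monic C m \<and> Cod C m = P} (subobject_equiv C P)"
proof (rule equivI)
  show "subobject_equiv C P \<subseteq> {m. monic C m \<and> Cod C m = P} \<times> {m. monic C m \<and> Cod C m = P}"
    by (auto simp: subobject_equiv_def)
  show "refl_on {m. monic C m \<and> Cod C m = P} (subobject_equiv C P)"
  proof (rule refl_onI)
    fix m assume m: "m \<in> {m. monic C m \<and> Cod C m = P}"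
    then have "Id C (Dom C m) \<in> arrows C (Dom C m) (Dom C m)" "m \<cdot> Id C (Dom C m) = m"
      using monic_Arr by (auto simp: arrow_simps)
    then show "(m, m) \<in> subobject_equiv C P"
      using m by (subst subobject_equiv_iff) auto
  qed
  have mono: "monic C m" "Cod C m = P" "monic C n" "Cod C n = P"
    if "(m, n) \<in> subobject_equiv C P" for m n
    using that by (auto simp: subobject_equiv_def)
  show "sym (subobject_equiv C P)"
  proof (rule symI)
    fix m n assume mn: "(m, n) \<in> subobject_equiv C P"
    note t = mono[OF mn]
    show "(n, m) \<in> subobject_equiv C P"
      using mn by (simp add: subobject_equiv_iff t)
  qed
  show "trans (subobject_equiv C P)"
  proof (rule transI)
    fix l m n assume lm: "(l, m) \<in> subobject_equiv C P" and mn: "(m, n) \<in> subobject_equiv C P"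
    note t = mono[OF lm] mono[OF mn]
    show "(l, n) \<in> subobject_equiv C P"
      using lm mn factor_trans[of l m n] factor_trans[of n m l] t monic_Arr
      by (simp add: subobject_equiv_iff)
  qed
qed

lemma subobjectsD:
  assumes "R \<in> subobjects C P"
  shows "\<exists>r. r \<in> R"
    and "r \<in> R \<Longrightarrow> monic C r \<and> Cod C r = P"
    and "\<lbrakk>r \<in> R; s \<in> R\<rbrakk> \<Longrightarrow> (r, s) \<in> subobject_equiv C P"
    and "\<lbrakk>r \<in> R; (r, s) \<in> subobject_equiv C P\<rbrakk> \<Longrightarrow> s \<in> R"
  using assms equiv_subobject_equiv[of P] unfolding subobjects_def
  by (auto dest: in_quotient_imp_non_empty in_quotient_imp_subset quotient_eq_iff
      in_quotient_imp_closed)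

lemma subobjectsI:
  assumes "r \<in> R" and mono: "\<And>r. r \<in> R \<Longrightarrow> monic C r \<and> Cod C r = P"
    and factor: "\<And>r s. \<lbrakk>r \<in> R; s \<in> R\<rbrakk> \<Longrightarrow> \<exists>h\<in>arrows C (Dom C r) (Dom C s). s \<cdot> h = r"
    and closed: "\<And>r s. \<lbrakk>r \<in> R; (r, s) \<in> subobject_equiv C P\<rbrakk> \<Longrightarrow> s \<in> R"
  shows "R \<in> subobjects C P"
proof -
  have "(r, s) \<in> subobject_equiv C P" if "s \<in> R" for s
    using that assms(1) mono factor by (simp add: subobject_equiv_iff)
  with closed[OF assms(1)] have "R = subobject_equiv C P `` {r}" by blast
  then show ?thesis
    using mono[OF assms(1)] unfolding subobjects_def by (auto intro: quotientI)
qed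

lemma subobject_le_iff:
  assumes R: "R \<in> subobjects C P" "r \<in> R" and S: "S \<in> subobjects C P" "s \<in> S"
  shows "subobject_le C R S \<longleftrightarrow> (\<exists>h\<in>arrows C (Dom C r) (Dom C s). s \<cdot> h = r)"
proof
  assume "subobject_le C R S"
  then obtain r' s' where rs: "r' \<in> R" "s' \<in> S" "\<exists>h\<in>arrows C (Dom C r') (Dom C s'). s' \<cdot> h = r'"
    by (auto simp: subobject_le_def)
  note m = subobjectsD(2)[OF R] subobjectsD(2)[OF S] subobjectsD(2)[OF R(1) rs(1)]
    subobjectsD(2)[OF S(1) rs(2)]
  have "\<exists>h\<in>arrows C (Dom C r) (Dom C r'). r' \<cdot> h = r" "\<exists>h\<in>arrows C (Dom C s') (Dom C s). s \<cdot> h = s'"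
    using subobjectsD(3)[OF R rs(1)] subobjectsD(3)[OF S rs(2)] m by (simp_all add: subobject_equiv_iff)
  then show "\<exists>h\<in>arrows C (Dom C r) (Dom C s). s \<cdot> h = r"
    using factor_trans[of r r' s'] factor_trans[of r s' s] m rs(3) monic_Arr by blast
qed (use assms in \<open>auto simp: subobject_le_def\<close>)

end

section \<open>Pullbacks, squares and images\<close>

context regular_category
begin

lemma ex_product:
  assumes "X \<in> Obj C" "Y \<in> Obj C"
  shows "\<exists>P. is_product C X Y P"
proof -
  have "is_diagram C [X, Y] {}"
    using assms by (simp add: is_diagram_def)
  from finite_limits[OF this] obtain L ps where lim: "is_limit C [X, Y] {} L ps" by blast
  then have "ps ! 0 \<in> arrows C L X" "ps ! 1 \<in> arrows C L Y"
    by (auto simp: is_limit_def is_cone_def All_less_Suc)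
  moreover have "\<exists>!h. h \<in> arrows C A L \<and> ps ! 0 \<cdot> h = u \<and> ps ! 1 \<cdot> h = v"
    if "u \<in> arrows C A X" "v \<in> arrows C A Y" for A u v
  proof -
    have "is_cone C [X, Y] {} A [u, v]"
      using that by (auto simp: is_cone_def All_less_Suc arrow_simps)
    then have "\<exists>!h. h \<in> arrows C A L \<and> (\<forall>i < length [X, Y]. (ps ! i) \<cdot> h = [u, v] ! i)"
      using lim by (simp only: is_limit_def)
    then show ?thesis by (simp add: All_less_Suc conj_commute)
  qed
  ultimately have "is_product C X Y (L, ps ! 0, ps ! 1)"
    by (auto simp: is_product_def)
  then show ?thesis by blast
qed

lemma ex_pullback:
  assumes "f \<in> arrows C A Z" "g \<in> arrows C B Z"
  shows "\<exists>p q. is_pullback C f g p q"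
proof -
  let ?xs = "[A, B, Z]" and ?E = "{(0, 2, f), (1, 2, g)} :: (nat \<times> nat \<times> 'b) set"
  have "is_diagram C ?xs ?E"
    using assms by (auto simp: is_diagram_def arrow_simps)
  from finite_limits[OF this] obtain L ps where lim: "is_limit C ?xs ?E L ps" by blast
  then have ps: "ps ! 0 \<in> arrows C L A" "ps ! 1 \<in> arrows C L B" "f \<cdot> ps ! 0 = g \<cdot> ps ! 1"
    "ps ! 2 = f \<cdot> ps ! 0"
    by (auto simp: is_limit_def is_cone_def All_less_Suc)
  have "\<exists>!h. h \<in> arrows C D L \<and> ps ! 0 \<cdot> h = u \<and> ps ! 1 \<cdot> h = v"
    if uv: "u \<in> arrows C D A" "v \<in> arrows C D B" "f \<cdot> u = g \<cdot> v" for D u v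
  proof -
    have "is_cone C ?xs ?E D [u, v, f \<cdot> u]"
      using uv assms by (auto simp: is_cone_def All_less_Suc arrow_simps)
    then have "\<exists>!h. h \<in> arrows C D L \<and> (\<forall>i < length ?xs. (ps ! i) \<cdot> h = [u, v, f \<cdot> u] ! i)"
      using lim by (simp only: is_limit_def)
    moreover have "(\<forall>i < length ?xs. (ps ! i) \<cdot> h = [u, v, f \<cdot> u] ! i) \<longleftrightarrow>
        ps ! 0 \<cdot> h = u \<and> ps ! 1 \<cdot> h = v" if h: "h \<in> arrows C D L" for h
    proof -
      have "ps ! 2 \<cdot> h = f \<cdot> (ps ! 0 \<cdot> h)"
        using h ps(1,4) assms by (simp add: arrow_simps)
      then show ?thesis by (auto simp: All_less_Suc numeral_2_eq_2)
    qed
    ultimately show ?thesis by (metis (no_types, lifting))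
  qed
  then have "is_pullback C f g (ps ! 0) (ps ! 1)"
    using ps assms by (auto simp: is_pullback_def arrows_def)
  then show ?thesis by blast
qed

text \<open>Regular epimorphisms behave as covers: along them any generalized element lifts locally.\<close>

lemma regular_epi_lift:
  assumes e: "regular_epi C e" "e \<in> arrows C P M" and h: "h \<in> arrows C A M"
  obtains B c q where "regular_epi C c" "c \<in> arrows C B A" "q \<in> arrows C B P" "e \<cdot> q = h \<cdot> c"
proof -
  obtain q c where pb: "is_pullback C e h q c"
    using ex_pullback e h by blast
  show thesis
    by (rule that[OF regular_epi_stable[OF e(1) pb], of "Dom C q" q])
      (use pb e h in \<open>auto simp: is_pullback_def arrows_def\<close>)
qed

text \<open>The image of \<open>f\<close> is obtained from the coequalizer \<open>q\<close> of its kernel pair. The induced \<open>m\<close> is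
  monic: if \<open>m\<close> identifies \<open>a\<close> and \<open>b\<close>, then on a cover both lift along \<open>q\<close>, the lifts are identified
  by \<open>f\<close>, hence by \<open>q\<close>.\<close>

lemma ex_image:
  assumes f: "f \<in> arrows C A B"
  obtains m e where "monic C m" "Cod C m = B" "regular_epi C e" "e \<in> arrows C A (Dom C m)" "m \<cdot> e = f"
proof -
  obtain p1 p2 where pb: "is_pullback C f f p1 p2"
    using ex_pullback f by blast
  then obtain q where q: "is_coequalizer C p1 p2 q"
    using kernel_pair_coequalizer by blast
  have p: "p1 \<in> Arr C" "p2 \<in> Arr C" "Dom C p2 = Dom C p1" "Cod C p1 = A" "Cod C p2 = A"
      "f \<cdot> p1 = f \<cdot> p2"
    using pb f by (auto simp: is_pullback_def arrows_def)
  then have qq: "q \<in> arrows C A (Cod C q)" "q \<cdot> p1 = q \<cdot> p2" "regular_epi C q"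
    using q by (auto simp: is_coequalizer_def arrows_def regular_epi_def)
  have "f \<in> arrows C (Cod C p1) B"
    using f p(4) by simp
  then obtain m where m: "m \<in> arrows C (Cod C q) B" "m \<cdot> q = f"
    using coequalizer_factor[OF q _ p(6)] by blast
  have "a = b" if ab: "a \<in> arrows C D (Cod C q)" "b \<in> arrows C D (Cod C q)" "m \<cdot> a = m \<cdot> b" for D a b
  proof -
    obtain D1 c1 x where 1: "regular_epi C c1" "c1 \<in> arrows C D1 D" "x \<in> arrows C D1 A"
        "q \<cdot> x = a \<cdot> c1"
      using regular_epi_lift[OF qq(3,1) ab(1)] by blast
    obtain D2 c2 y where 2: "regular_epi C c2" "c2 \<in> arrows C D2 D1" "y \<in> arrows C D2 A"
        "q \<cdot> y = (b \<cdot> c1) \<cdot> c2"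
      using regular_epi_lift[OF qq(3,1) Comp_in_arrows[OF 1(2) ab(2)]] by blast
    have "f \<cdot> (x \<cdot> c2) = m \<cdot> ((q \<cdot> x) \<cdot> c2)"
      using m(1) qq(1) 1(2,3) 2(2,3) by (simp add: arrow_simps flip: m(2))
    also have "\<dots> = (m \<cdot> a) \<cdot> (c1 \<cdot> c2)"
      using m(1) 1(2) 2(2) ab(1) by (simp add: 1(4) arrow_simps)
    also have "\<dots> = m \<cdot> (q \<cdot> y)"
      using m(1) 1(2) 2(2) ab(2) by (simp add: 2(4) ab(3) arrow_simps)
    also have "\<dots> = f \<cdot> y"
      using m(1) qq(1) 2(3) by (simp add: arrow_simps flip: m(2))
    finally have "f \<cdot> (x \<cdot> c2) = f \<cdot> y" .
    moreover have "x \<cdot> c2 \<in> arrows C D2 (Dom C f)" "y \<in> arrows C D2 (Dom C f)"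
      using 1 2 f by (auto simp: arrow_simps)
    ultimately obtain h where h: "h \<in> arrows C D2 (Dom C p1)" "p1 \<cdot> h = x \<cdot> c2" "p2 \<cdot> h = y"
      using pullback_factor[OF pb] by blast
    have "q \<cdot> (p1 \<cdot> h) = (q \<cdot> p1) \<cdot> h" "q \<cdot> (p2 \<cdot> h) = (q \<cdot> p2) \<cdot> h"
      using qq(1) p h(1) by (simp_all add: arrow_simps)
    then have "q \<cdot> (x \<cdot> c2) = q \<cdot> y"
      using h qq(2) by simp
    moreover have "q \<cdot> (x \<cdot> c2) = (a \<cdot> c1) \<cdot> c2"
      using qq(1) 1(3) 2(2) by (simp add: arrow_simps flip: 1(4))
    ultimately have 3: "(a \<cdot> c1) \<cdot> c2 = (b \<cdot> c1) \<cdot> c2"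
      using 2(4) by simp
    have 4: "a \<cdot> c1 = b \<cdot> c1"
      by (rule regular_epi_cancel[OF 2(1), of _ "Cod C q"]) (use 1 2 3 ab in \<open>auto simp: arrow_simps\<close>)
    show "a = b"
      by (rule regular_epi_cancel[OF 1(1), of _ "Cod C q"]) (use 1 4 ab in \<open>auto simp: arrow_simps\<close>)
  qed
  then have "monic C m"
    using m(1) by (auto simp: monic_def arrows_def)
  then show thesis
    using that[of m q] m qq by (auto simp: arrows_def)
qed

end

section \<open>Relations through generalized elements\<close>

text \<open>Membership of a pair of generalized elements of \<open>X\<close> at stage \<open>A\<close>. It is phrased with the two
  projections, so that opposites and composites can be computed componentwise; that it amounts
  to a factorization of the induced arrow \<open>A \<rightarrow> X \<times> X\<close> through any chosen representative of \<open>R\<close>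
  is \<open>related_iff\<close>.\<close>

definition related :: "('o, 'm) category \<Rightarrow> 'o \<Rightarrow> 'o \<Rightarrow> 'm set \<Rightarrow> 'm \<Rightarrow> 'm \<Rightarrow> bool" where
  "related C X A R x y \<longleftrightarrow> (\<exists>r\<in>R. \<exists>h\<in>arrows C A (Dom C r).
    pr1 C X \<cdot>\<^bsub>C\<^esub> (r \<cdot>\<^bsub>C\<^esub> h) = x \<and> pr2 C X \<cdot>\<^bsub>C\<^esub> (r \<cdot>\<^bsub>C\<^esub> h) = y)"

context regular_category
begin

context
  fixes X :: 'a
  assumes X: "X \<in> Obj C"
begin

lemma square_product: "is_product C X X (sq C X, pr1 C X, pr2 C X)"
  using someI_ex[OF ex_product[OF X X]] by (simp add: sq_def pr1_def pr2_def square_def)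

lemma pr_arrows: "pr1 C X \<in> arrows C (sq C X) X" "pr2 C X \<in> arrows C (sq C X) X"
  using square_product by (simp_all add: is_product_def)

lemma pr_Arr:
  "pr1 C X \<in> Arr C" "Dom C (pr1 C X) = sq C X" "Cod C (pr1 C X) = X"
  "pr2 C X \<in> Arr C" "Dom C (pr2 C X) = sq C X" "Cod C (pr2 C X) = X"
  using pr_arrows by (auto simp: arrows_def)

lemma square_factor:
  assumes "x \<in> arrows C A X" "y \<in> arrows C A X"
  shows "\<exists>!h. h \<in> arrows C A (sq C X) \<and> pr1 C X \<cdot> h = x \<and> pr2 C X \<cdot> h = y"
  using square_product assms unfolding is_product_def by blast

lemma pairing:
  assumes "x \<in> arrows C A X" "y \<in> arrows C A X"
  shows "pairing C X x y \<in> arrows C A (sq C X)"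
    "pr1 C X \<cdot> pairing C X x y = x" "pr2 C X \<cdot> pairing C X x y = y"
proof -
  have "Dom C x = A" using assms by (simp add: arrows_def)
  then show "pairing C X x y \<in> arrows C A (sq C X)"
    "pr1 C X \<cdot> pairing C X x y = x" "pr2 C X \<cdot> pairing C X x y = y"
    using theI'[OF square_factor[OF assms]] by (simp_all add: pairing_def)
qed

lemma square_eqI:
  assumes "a \<in> arrows C A (sq C X)" "b \<in> arrows C A (sq C X)"
    and "pr1 C X \<cdot> a = pr1 C X \<cdot> b" "pr2 C X \<cdot> a = pr2 C X \<cdot> b"
  shows "a = b"
proof -
  obtain k where "\<And>h. h \<in> arrows C A (sq C X) \<and> pr1 C X \<cdot> h = pr1 C X \<cdot> b \<and> pr2 C X \<cdot> h = pr2 C X \<cdot> b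
      \<Longrightarrow> h = k"
    using square_factor[OF Comp_in_arrows[OF assms(2) pr_arrows(1)]
        Comp_in_arrows[OF assms(2) pr_arrows(2)]] by metis
  from this[of a] this[of b] show ?thesis using assms by simp
qed

lemma relationsD:
  assumes "R \<in> relations C X"
  shows "\<exists>r. r \<in> R" and "r \<in> R \<Longrightarrow> monic C r" and "r \<in> R \<Longrightarrow> r \<in> arrows C (Dom C r) (sq C X)"
  using subobjectsD(1)[OF assms[unfolded relations_def]]
    subobjectsD(2)[OF assms[unfolded relations_def], of r] monic_Arr[of r]
  by (simp_all add: arrows_def)

lemma relatedI:
  "\<lbrakk>r \<in> R; h \<in> arrows C A (Dom C r); pr1 C X \<cdot> (r \<cdot> h) = x; pr2 C X \<cdot> (r \<cdot> h) = y\<rbrakk>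
    \<Longrightarrow> related C X A R x y"
  by (auto simp: related_def)

lemma related_arrows:
  assumes "R \<in> relations C X" "related C X A R x y"
  shows "x \<in> arrows C A X" "y \<in> arrows C A X"
proof -
  obtain r h where rh: "r \<in> R" "h \<in> arrows C A (Dom C r)"
      "pr1 C X \<cdot> (r \<cdot> h) = x" "pr2 C X \<cdot> (r \<cdot> h) = y"
    using assms(2) by (auto simp: related_def)
  note * = Comp_in_arrows[OF rh(2) relationsD(3)[OF assms(1) rh(1)]]
  show "x \<in> arrows C A X" "y \<in> arrows C A X"
    using rh(3,4) Comp_in_arrows[OF * pr_arrows(1)] Comp_in_arrows[OF * pr_arrows(2)] by simp_all
qed

lemma related_iff:
  assumes R: "R \<in> relations C X" and r: "r \<in> R" and x: "x \<in> arrows C A X" and y: "y \<in> arrows C A X"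
  shows "related C X A R x y \<longleftrightarrow> (\<exists>h\<in>arrows C A (Dom C r). r \<cdot> h = pairing C X x y)"
proof
  assume "related C X A R x y"
  then obtain r' h where rh: "r' \<in> R" "h \<in> arrows C A (Dom C r')"
      "pr1 C X \<cdot> (r' \<cdot> h) = x" "pr2 C X \<cdot> (r' \<cdot> h) = y"
    by (auto simp: related_def)
  note r'A = relationsD(3)[OF R rh(1)] and rA = relationsD(3)[OF R r]
  have "(r', r) \<in> subobject_equiv C (sq C X)"
    using subobjectsD(3)[OF R[unfolded relations_def] rh(1) r] .
  then obtain k where k: "k \<in> arrows C (Dom C r') (Dom C r)" "r \<cdot> k = r'"
    by (auto simp: subobject_equiv_def)
  have "r' \<cdot> h = pairing C X x y"
    by (rule square_eqI[of _ A]) (use rh pairing[OF x y] Comp_in_arrows[OF rh(2) r'A] in auto)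
  moreover have "r \<cdot> (k \<cdot> h) = r' \<cdot> h"
    using Comp_assoc[OF rh(2) k(1) rA] k(2) by simp
  ultimately show "\<exists>h\<in>arrows C A (Dom C r). r \<cdot> h = pairing C X x y"
    using Comp_in_arrows[OF rh(2) k(1)] by auto
next
  assume "\<exists>h\<in>arrows C A (Dom C r). r \<cdot> h = pairing C X x y"
  then obtain h where "h \<in> arrows C A (Dom C r)" "r \<cdot> h = pairing C X x y" by blast
  then show "related C X A R x y"
    using relatedI[OF r, of h A x y] pairing[OF x y] by simp
qed

lemma related_reindex:
  assumes R: "R \<in> relations C X" and xy: "related C X A R x y" and a: "a \<in> arrows C B A"
  shows "related C X B R (x \<cdot> a) (y \<cdot> a)"
proof -
  obtain r h where rh: "r \<in> R" "h \<in> arrows C A (Dom C r)"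
      "pr1 C X \<cdot> (r \<cdot> h) = x" "pr2 C X \<cdot> (r \<cdot> h) = y"
    using xy by (auto simp: related_def)
  note rA = relationsD(3)[OF R rh(1)]
  have "pr1 C X \<cdot> (r \<cdot> (h \<cdot> a)) = (pr1 C X \<cdot> (r \<cdot> h)) \<cdot> a"
    "pr2 C X \<cdot> (r \<cdot> (h \<cdot> a)) = (pr2 C X \<cdot> (r \<cdot> h)) \<cdot> a"
    using rh(2) rA a by (simp_all add: arrow_simps pr_Arr)
  then show ?thesis
    using rh Comp_in_arrows[OF a rh(2)] unfolding related_def by blast
qed

text \<open>Membership is local for the covers given by regular epimorphisms, because a relation is a mono
  and regular epimorphisms are orthogonal to monos.\<close>

lemma related_local:
  assumes R: "R \<in> relations C X" and e: "regular_epi C e" "e \<in> arrows C B A"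
    and x: "x \<in> arrows C A X" and y: "y \<in> arrows C A X"
    and xy: "related C X B R (x \<cdot> e) (y \<cdot> e)"
  shows "related C X A R x y"
proof -
  obtain r where r: "r \<in> R" using relationsD(1)[OF R] by blast
  note rA = relationsD(3)[OF R r]
  note xe = Comp_in_arrows[OF e(2) x] and ye = Comp_in_arrows[OF e(2) y]
  obtain h where h: "h \<in> arrows C B (Dom C r)" "r \<cdot> h = pairing C X (x \<cdot> e) (y \<cdot> e)"
    using related_iff[OF R r xe ye] xy by blast
  have "pairing C X (x \<cdot> e) (y \<cdot> e) = pairing C X x y \<cdot> e"
  proof (rule square_eqI[of _ B])
    note p = Comp_assoc[OF e(2) pairing(1)[OF x y]]
    show "pr1 C X \<cdot> pairing C X (x \<cdot> e) (y \<cdot> e) = pr1 C X \<cdot> (pairing C X x y \<cdot> e)"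
      "pr2 C X \<cdot> pairing C X (x \<cdot> e) (y \<cdot> e) = pr2 C X \<cdot> (pairing C X x y \<cdot> e)"
      using pairing[OF xe ye] pairing[OF x y] p[OF pr_arrows(1)] p[OF pr_arrows(2)] by simp_all
  qed (use pairing(1)[OF xe ye] pairing(1)[OF x y] e(2) Comp_in_arrows in blast)+
  moreover have "pairing C X x y \<in> arrows C A (Cod C r)"
    using pairing(1)[OF x y] rA by (simp add: arrows_def)
  ultimately obtain k where "k \<in> arrows C A (Dom C r)" "r \<cdot> k = pairing C X x y"
    using regular_epi_diagonal[OF e relationsD(2)[OF R r] h(1)] h(2) by metis
  then show ?thesis
    using related_iff[OF R r x y] by blast
qed

lemma related_generic:
  assumes R: "R \<in> relations C X" and r: "r \<in> R"
  shows "related C X (Dom C r) R (pr1 C X \<cdot> r) (pr2 C X \<cdot> r)"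
proof -
  note rA = relationsD(3)[OF R r]
  have "r \<cdot> Id C (Dom C r) = r" "Id C (Dom C r) \<in> arrows C (Dom C r) (Dom C r)"
    using rA by (simp_all add: arrow_simps)
  then show ?thesis
    using relatedI[OF r, of "Id C (Dom C r)" "Dom C r"] by simp
qed

lemma factor_if_related:
  assumes S: "S \<in> relations C X" "s \<in> S" and r: "r \<in> arrows C A (sq C X)"
    and "related C X A S (pr1 C X \<cdot> r) (pr2 C X \<cdot> r)"
  shows "\<exists>h\<in>arrows C A (Dom C s). s \<cdot> h = r"
proof -
  note p = Comp_in_arrows[OF r pr_arrows(1)] Comp_in_arrows[OF r pr_arrows(2)]
  have "pairing C X (pr1 C X \<cdot> r) (pr2 C X \<cdot> r) = r"
    by (rule square_eqI[OF pairing(1)[OF p] r]) (simp_all add: pairing[OF p])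
  then show ?thesis
    using related_iff[OF S p] assms(4) by simp
qed

text \<open>This is the Yoneda lemma for subobjects: from right to left, apply the hypothesis to the generic
  pair, namely the two projections of a representative of \<open>R\<close> itself.\<close>

lemma subobject_le_iff_related:
  assumes R: "R \<in> relations C X" and S: "S \<in> relations C X"
  shows "subobject_le C R S \<longleftrightarrow> (\<forall>A x y. related C X A R x y \<longrightarrow> related C X A S x y)"
proof -
  obtain r s where r: "r \<in> R" and s: "s \<in> S"
    using relationsD(1)[OF R] relationsD(1)[OF S] by blast
  note rA = relationsD(3)[OF R r] and sA = relationsD(3)[OF S s]
  have "subobject_le C R S \<longleftrightarrow> (\<exists>h\<in>arrows C (Dom C r) (Dom C s). s \<cdot> h = r)"
    using subobject_le_iff[OF R[unfolded relations_def] r S[unfolded relations_def] s] .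
  also have "\<dots> \<longleftrightarrow> (\<forall>A x y. related C X A R x y \<longrightarrow> related C X A S x y)"
  proof (intro iffI allI impI)
    fix A x y
    assume "\<exists>h\<in>arrows C (Dom C r) (Dom C s). s \<cdot> h = r" and xy: "related C X A R x y"
    then obtain k where k: "k \<in> arrows C (Dom C r) (Dom C s)" "s \<cdot> k = r" by blast
    note x = related_arrows[OF R xy]
    obtain h where h: "h \<in> arrows C A (Dom C r)" "r \<cdot> h = pairing C X x y"
      using related_iff[OF R r x] xy by blast
    have "s \<cdot> (k \<cdot> h) = pairing C X x y"
      using Comp_assoc[OF h(1) k(1) sA] k(2) h(2) by simp
    then show "related C X A S x y"
      using related_iff[OF S s x] Comp_in_arrows[OF h(1) k(1)] by blast
  next
    assume "\<forall>A x y. related C X A R x y \<longrightarrow> related C X A S x y"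
    then show "\<exists>h\<in>arrows C (Dom C r) (Dom C s). s \<cdot> h = r"
      using factor_if_related[OF S s rA] related_generic[OF R r] by blast
  qed
  finally show ?thesis .
qed

lemma subobject_leD:
  "\<lbrakk>subobject_le C R S; R \<in> relations C X; S \<in> relations C X; related C X A R x y\<rbrakk>
    \<Longrightarrow> related C X A S x y"
  using subobject_le_iff_related by blast

lemma subobject_leI:
  "\<lbrakk>R \<in> relations C X; S \<in> relations C X; \<And>A x y. related C X A R x y \<Longrightarrow> related C X A S x y\<rbrakk>
    \<Longrightarrow> subobject_le C R S"
  using subobject_le_iff_related by blast

lemma rel_le_refl: "R \<in> relations C X \<Longrightarrow> subobject_le C R R"
  by (simp add: subobject_leI)

lemma rel_le_trans:
  "\<lbrakk>subobject_le C R S; subobject_le C S T; R \<in> relations C X; S \<in> relations C X; T \<in> relations C X\<rbrakk>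
    \<Longrightarrow> subobject_le C R T"
  using subobject_le_iff_related by blast

section \<open>Diagonal, opposite and composite\<close>

lemma diagonal_monic:
  "monic C (pairing C X (Id C X) (Id C X))" (is "monic C ?d")
  "pairing C X (Id C X) (Id C X) \<in> arrows C X (sq C X)"
proof -
  have i: "Id C X \<in> arrows C X X" using Id_in_arrows[OF X] .
  show d: "?d \<in> arrows C X (sq C X)" using pairing(1)[OF i i] .
  have "f = g" if fg: "f \<in> arrows C A X" "g \<in> arrows C A X" "?d \<cdot> f = ?d \<cdot> g" for A f g
  proof -
    have "(pr1 C X \<cdot> ?d) \<cdot> f = (pr1 C X \<cdot> ?d) \<cdot> g"
      using fg(3) Comp_assoc[OF fg(1) d pr_arrows(1)] Comp_assoc[OF fg(2) d pr_arrows(1)] by simp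
    then show ?thesis
      using pairing(2)[OF i i] Comp_Id_left[OF fg(1)] Comp_Id_left[OF fg(2)] by simp
  qed
  then show "monic C ?d"
    using d by (auto simp: monic_def arrows_def)
qed

lemma rel_diag_mem: "pairing C X (Id C X) (Id C X) \<in> rel_diag C X" (is "?d \<in> _")
  and rel_diag_relations: "rel_diag C X \<in> relations C X"
proof -
  have d: "?d \<in> {m. monic C m \<and> Cod C m = sq C X}"
    using diagonal_monic by (auto simp: arrows_def)
  show "?d \<in> rel_diag C X"
    using equiv_class_self[OF equiv_subobject_equiv d] by (simp add: rel_diag_def)
  show "rel_diag C X \<in> relations C X"
    using quotientI[OF d] by (simp add: rel_diag_def relations_def subobjects_def)
qed

lemma related_rel_diag: "related C X A (rel_diag C X) x y \<longleftrightarrow> x \<in> arrows C A X \<and> x = y"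
proof -
  have i: "Id C X \<in> arrows C X X" using Id_in_arrows[OF X] .
  let ?d = "pairing C X (Id C X) (Id C X)"
  note d = pairing(1)[OF i i]
  have dh: "pr1 C X \<cdot> (?d \<cdot> h) = h" "pr2 C X \<cdot> (?d \<cdot> h) = h" if h: "h \<in> arrows C A X" for h
    using Comp_assoc[OF h d pr_arrows(1)] Comp_assoc[OF h d pr_arrows(2)]
      pairing[OF i i] Comp_Id_left[OF h] by simp_all
  have Dd: "Dom C ?d = X" using d by (simp add: arrows_def)
  show ?thesis
  proof
    assume xy: "related C X A (rel_diag C X) x y"
    note x = related_arrows[OF rel_diag_relations xy]
    obtain h where h: "h \<in> arrows C A X" "?d \<cdot> h = pairing C X x y"
      using related_iff[OF rel_diag_relations rel_diag_mem x] xy Dd by auto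
    then show "x \<in> arrows C A X \<and> x = y"
      using dh[OF h(1)] pairing[OF x] by simp
  next
    assume "x \<in> arrows C A X \<and> x = y"
    then show "related C X A (rel_diag C X) x y"
      unfolding related_def using rel_diag_mem dh Dd by metis
  qed
qed

lemma reflexive_rel_iff:
  "reflexive_rel C X R \<longleftrightarrow>
    R \<in> relations C X \<and> (\<forall>A x. x \<in> arrows C A X \<longrightarrow> related C X A R x x)"
  using subobject_le_iff_related[OF rel_diag_relations, of R]
  by (auto simp: reflexive_rel_def related_rel_diag)

lemma reflexive_relations: "reflexive_rel C X R \<Longrightarrow> R \<in> relations C X"
  by (simp add: reflexive_rel_def)

text \<open>Composition with the involution of \<open>X \<times> X\<close>, which is how \<open>rel_op\<close> acts on representatives.\<close>

definition swap :: "'b \<Rightarrow> 'b" where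
  "swap r = pairing C X (pr2 C X \<cdot> r) (pr1 C X \<cdot> r)"

lemma swap:
  assumes "r \<in> arrows C A (sq C X)"
  shows "swap r \<in> arrows C A (sq C X)" "pr1 C X \<cdot> swap r = pr2 C X \<cdot> r" "pr2 C X \<cdot> swap r = pr1 C X \<cdot> r"
  using pairing[OF Comp_in_arrows[OF assms pr_arrows(2)] Comp_in_arrows[OF assms pr_arrows(1)]]
  by (simp_all add: swap_def)

lemma swap_swap:
  assumes "r \<in> arrows C A (sq C X)"
  shows "swap (swap r) = r"
  by (rule square_eqI[of _ A])
    (use assms swap[OF assms] swap[OF swap(1)[OF assms]] in auto)

lemma swap_Comp:
  assumes r: "r \<in> arrows C A (sq C X)" and h: "h \<in> arrows C B A"
  shows "swap (r \<cdot> h) = swap r \<cdot> h"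
proof (rule square_eqI[of _ B])
  note rh = Comp_in_arrows[OF h r]
  note c = Comp_assoc[OF h swap(1)[OF r] pr_arrows(1)] Comp_assoc[OF h swap(1)[OF r] pr_arrows(2)]
    Comp_assoc[OF h r pr_arrows(1)] Comp_assoc[OF h r pr_arrows(2)]
  show "swap (r \<cdot> h) \<in> arrows C B (sq C X)" using swap(1)[OF rh] .
  show "swap r \<cdot> h \<in> arrows C B (sq C X)" using Comp_in_arrows[OF h swap(1)[OF r]] .
  show "pr1 C X \<cdot> swap (r \<cdot> h) = pr1 C X \<cdot> (swap r \<cdot> h)"
    "pr2 C X \<cdot> swap (r \<cdot> h) = pr2 C X \<cdot> (swap r \<cdot> h)"
    using c swap(2,3)[OF rh] swap(2,3)[OF r] by simp_all
qed

lemma swap_monic: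
  assumes m: "monic C r" and r: "r \<in> arrows C A (sq C X)"
  shows "monic C (swap r)"
proof -
  have D: "Dom C (swap r) = A" "Dom C r = A" "swap r \<in> Arr C"
    using swap(1)[OF r] r by (auto simp: arrows_def)
  have "f = g" if fg: "f \<in> arrows C B A" "g \<in> arrows C B A" "swap r \<cdot> f = swap r \<cdot> g" for B f g
  proof -
    have "r \<cdot> f = swap (swap (r \<cdot> f))"
      by (rule swap_swap[OF Comp_in_arrows[OF fg(1) r], symmetric])
    also have "\<dots> = swap (swap (r \<cdot> g))"
      by (simp only: swap_Comp[OF r fg(1)] swap_Comp[OF r fg(2)] fg(3))
    also have "\<dots> = r \<cdot> g"
      by (rule swap_swap[OF Comp_in_arrows[OF fg(2) r]])
    finally have "r \<cdot> f = r \<cdot> g" .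
    then show ?thesis
      using monicD[OF m, of f B g] fg D by simp
  qed
  then show ?thesis
    unfolding monic_def D using D(3) by simp
qed

lemma swap_subobject_equiv:
  assumes "(r, s) \<in> subobject_equiv C (sq C X)"
  shows "(swap r, swap s) \<in> subobject_equiv C (sq C X)"
proof -
  obtain h where h: "h \<in> arrows C (Dom C r) (Dom C s)" "isomorphism C h" "s \<cdot> h = r"
    and m: "monic C r" "Cod C r = sq C X" "monic C s" "Cod C s = sq C X"
    using assms by (auto simp: subobject_equiv_def)
  have r: "r \<in> arrows C (Dom C r) (sq C X)" and s: "s \<in> arrows C (Dom C s) (sq C X)"
    using m monic_Arr by (auto simp: arrows_def)
  have "swap s \<cdot> h = swap r"
    using swap_Comp[OF s h(1)] h(3) by simp
  moreover have "Dom C (swap r) = Dom C r" "Cod C (swap r) = sq C X"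
      "Dom C (swap s) = Dom C s" "Cod C (swap s) = sq C X"
    using swap(1)[OF r] swap(1)[OF s] by (simp_all add: arrows_def)
  ultimately show ?thesis
    using h(1,2) swap_monic[OF m(1) r] swap_monic[OF m(3) s] by (auto simp: subobject_equiv_def)
qed

lemma rel_op_swap: "rel_op C X R = swap ` R"
  by (simp add: rel_op_def swap_def)

lemma rel_op_relations:
  assumes R: "R \<in> relations C X"
  shows "rel_op C X R \<in> relations C X"
proof -
  note R' = R[unfolded relations_def]
  obtain r where r: "r \<in> R" using relationsD(1)[OF R] by blast
  have "swap ` R \<in> subobjects C (sq C X)"
  proof (rule subobjectsI)
    show "swap r \<in> swap ` R" using r by blast
    show "monic C s \<and> Cod C s = sq C X" if "s \<in> swap ` R" for s
      using that swap_monic swap(1) relationsD[OF R] by (fastforce simp: arrows_def)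
    show "\<exists>h\<in>arrows C (Dom C s) (Dom C t). t \<cdot> h = s" if "s \<in> swap ` R" "t \<in> swap ` R" for s t
    proof -
      have "(s, t) \<in> subobject_equiv C (sq C X)"
        using that swap_subobject_equiv subobjectsD(3)[OF R'] by blast
      then show ?thesis by (auto simp: subobject_equiv_def)
    qed
    show "t \<in> swap ` R" if s: "s \<in> swap ` R" and st: "(s, t) \<in> subobject_equiv C (sq C X)" for s t
    proof -
      obtain s' where s': "s' \<in> R" "s = swap s'" using s by blast
      have "t \<in> arrows C (Dom C t) (sq C X)"
        using st monic_Arr by (auto simp: subobject_equiv_def arrows_def)
      moreover have "(s', swap t) \<in> subobject_equiv C (sq C X)"
        using swap_subobject_equiv[OF st] s' swap_swap relationsD(3)[OF R s'(1)] by simp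
      ultimately show ?thesis
        using subobjectsD(4)[OF R' s'(1)] swap_swap by (metis imageI)
    qed
  qed
  then show ?thesis by (simp add: rel_op_swap relations_def)
qed

lemma related_rel_op:
  assumes R: "R \<in> relations C X"
  shows "related C X A (rel_op C X R) x y \<longleftrightarrow> related C X A R y x"
proof -
  have "Dom C (swap r) = Dom C r \<and> (\<forall>h\<in>arrows C A (Dom C r).
      pr1 C X \<cdot> (swap r \<cdot> h) = pr2 C X \<cdot> (r \<cdot> h) \<and> pr2 C X \<cdot> (swap r \<cdot> h) = pr1 C X \<cdot> (r \<cdot> h))"
    if "r \<in> R" for r
  proof -
    note r = relationsD(3)[OF R that]
    have "Dom C (swap r) = Dom C r" using swap(1)[OF r] by (simp add: arrows_def)
    then show ?thesis
      using swap_Comp[OF r] swap(2,3)[OF Comp_in_arrows[OF _ r]] by simp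
  qed
  then show ?thesis
    unfolding related_def rel_op_swap by auto
qed

text \<open>The pullback in the definition of \<open>rel_comp\<close> classifies the composable pairs, and the regular
  epimorphism onto the image turns an element of the image into a composable pair on a cover.\<close>

lemma rel_comp_factor_iff:
  assumes R: "R \<in> relations C X" and S: "S \<in> relations C X" and m: "m \<in> rel_comp C X S R"
    and x: "x \<in> arrows C A X" and z: "z \<in> arrows C A X"
  shows "(\<exists>h\<in>arrows C A (Dom C m). m \<cdot> h = pairing C X x z) \<longleftrightarrow>
    (\<exists>B c y. regular_epi C c \<and> c \<in> arrows C B A \<and> related C X B R (x \<cdot> c) y \<and> related C X B S y (z \<cdot> c))"
    (is "?L \<longleftrightarrow> ?R")
proof -
  obtain r s u v e where mm: "monic C m" "Cod C m = sq C X" and r: "r \<in> R" and s: "s \<in> S"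
    and pb: "is_pullback C (pr2 C X \<cdot> r) (pr1 C X \<cdot> s) u v"
    and e: "regular_epi C e" "e \<in> arrows C (Dom C u) (Dom C m)"
    and me: "m \<cdot> e = pairing C X (pr1 C X \<cdot> r \<cdot> u) (pr2 C X \<cdot> s \<cdot> v)"
    using m by (auto simp: rel_comp_def)
  note rA = relationsD(3)[OF R r] and sA = relationsD(3)[OF S s]
  have mA: "m \<in> arrows C (Dom C m) (sq C X)" using mm monic_Arr by (auto simp: arrows_def)
  define P where "P = Dom C u"
  have u: "u \<in> arrows C P (Dom C r)" and v: "v \<in> arrows C P (Dom C s)"
    and uv: "(pr2 C X \<cdot> r) \<cdot> u = (pr1 C X \<cdot> s) \<cdot> v"
    using pb rA sA by (auto simp: is_pullback_def arrow_simps pr_Arr P_def)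
  note eA = e(2)[folded P_def]
  note ru = Comp_in_arrows[OF u rA] and sv = Comp_in_arrows[OF v sA]
  have r1: "pr1 C X \<cdot> r \<cdot> u \<in> arrows C P X" and s2: "pr2 C X \<cdot> s \<cdot> v \<in> arrows C P X"
    using u v rA sA by (simp_all add: arrow_simps pr_Arr)
  note me1 = pairing(2)[OF r1 s2, folded me] and me2 = pairing(3)[OF r1 s2, folded me]
  show ?thesis
  proof
    assume ?L
    then obtain h where h: "h \<in> arrows C A (Dom C m)" "m \<cdot> h = pairing C X x z" by blast
    obtain B c q where c: "regular_epi C c" "c \<in> arrows C B A" "q \<in> arrows C B P" "e \<cdot> q = h \<cdot> c"
      using regular_epi_lift[OF e(1) eA h(1)] .
    have mh: "pr1 C X \<cdot> (m \<cdot> h) = x" "pr2 C X \<cdot> (m \<cdot> h) = z"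
      using h(2) pairing[OF x z] by simp_all
    have "x \<cdot> c = pr1 C X \<cdot> (m \<cdot> (h \<cdot> c))" "z \<cdot> c = pr2 C X \<cdot> (m \<cdot> (h \<cdot> c))"
      unfolding mh[symmetric] using mA h(1) c(2) by (simp_all add: arrow_simps pr_Arr)
    then have "x \<cdot> c = pr1 C X \<cdot> (m \<cdot> (e \<cdot> q))" "z \<cdot> c = pr2 C X \<cdot> (m \<cdot> (e \<cdot> q))"
      by (simp_all add: c(4))
    then have "x \<cdot> c = (pr1 C X \<cdot> (m \<cdot> e)) \<cdot> q" "z \<cdot> c = (pr2 C X \<cdot> (m \<cdot> e)) \<cdot> q"
      using mA eA c(3) by (simp_all add: arrow_simps pr_Arr)
    then have xc: "x \<cdot> c = pr1 C X \<cdot> (r \<cdot> (u \<cdot> q))" and zc: "z \<cdot> c = pr2 C X \<cdot> (s \<cdot> (v \<cdot> q))"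
      unfolding me1 me2 using rA sA u v c(3) by (simp_all add: arrow_simps pr_Arr)
    have "(pr2 C X \<cdot> r \<cdot> u) \<cdot> q = (pr1 C X \<cdot> s \<cdot> v) \<cdot> q"
      by (simp add: uv)
    then have y: "pr2 C X \<cdot> (r \<cdot> (u \<cdot> q)) = pr1 C X \<cdot> (s \<cdot> (v \<cdot> q))"
      using rA sA u v c(3) by (simp add: arrow_simps pr_Arr)
    have "related C X B R (x \<cdot> c) (pr2 C X \<cdot> (r \<cdot> (u \<cdot> q)))"
      by (rule relatedI[OF r Comp_in_arrows[OF c(3) u]]) (simp_all add: xc)
    moreover have "related C X B S (pr2 C X \<cdot> (r \<cdot> (u \<cdot> q))) (z \<cdot> c)"
      by (rule relatedI[OF s Comp_in_arrows[OF c(3) v]]) (simp_all add: y zc)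
    ultimately show ?R using c by blast
  next
    assume ?R
    then obtain B c y where c: "regular_epi C c" "c \<in> arrows C B A"
      and xy: "related C X B R (x \<cdot> c) y" and yz: "related C X B S y (z \<cdot> c)" by blast
    note xc = related_arrows[OF R xy] and zc = related_arrows[OF S yz]
    obtain a where a: "a \<in> arrows C B (Dom C r)" "r \<cdot> a = pairing C X (x \<cdot> c) y"
      using related_iff[OF R r xc] xy by blast
    obtain b where b: "b \<in> arrows C B (Dom C s)" "s \<cdot> b = pairing C X y (z \<cdot> c)"
      using related_iff[OF S s zc] yz by blast
    have "(pr2 C X \<cdot> r) \<cdot> a = (pr1 C X \<cdot> s) \<cdot> b"
      using Comp_assoc[OF a(1) rA pr_arrows(2)] Comp_assoc[OF b(1) sA pr_arrows(1)]
        a(2) b(2) pairing[OF xc] pairing[OF zc] by simp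
    moreover have "a \<in> arrows C B (Dom C (pr2 C X \<cdot> r))" "b \<in> arrows C B (Dom C (pr1 C X \<cdot> s))"
      using a(1) b(1) rA sA by (simp_all add: arrow_simps pr_Arr)
    ultimately obtain k where k: "k \<in> arrows C B P" "u \<cdot> k = a" "v \<cdot> k = b"
      using pullback_factor[OF pb] unfolding P_def by blast
    have "pr1 C X \<cdot> (m \<cdot> (e \<cdot> k)) = (pr1 C X \<cdot> (m \<cdot> e)) \<cdot> k"
      "pr2 C X \<cdot> (m \<cdot> (e \<cdot> k)) = (pr2 C X \<cdot> (m \<cdot> e)) \<cdot> k"
      using mA eA k(1) by (simp_all add: arrow_simps pr_Arr)
    then have "pr1 C X \<cdot> (m \<cdot> (e \<cdot> k)) = pr1 C X \<cdot> (r \<cdot> (u \<cdot> k))"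
      "pr2 C X \<cdot> (m \<cdot> (e \<cdot> k)) = pr2 C X \<cdot> (s \<cdot> (v \<cdot> k))"
      unfolding me1 me2 using rA sA u v k(1) by (simp_all add: arrow_simps pr_Arr)
    then have mek: "pr1 C X \<cdot> (m \<cdot> (e \<cdot> k)) = x \<cdot> c" "pr2 C X \<cdot> (m \<cdot> (e \<cdot> k)) = z \<cdot> c"
      using k(2,3) a(2) b(2) pairing[OF xc] pairing[OF zc] by simp_all
    note xz = pairing[OF x z]
    have ek: "e \<cdot> k \<in> arrows C B (Dom C m)" using Comp_in_arrows[OF k(1) eA] .
    have "m \<cdot> (e \<cdot> k) = pairing C X x z \<cdot> c"
      by (rule square_eqI[OF Comp_in_arrows[OF ek mA] Comp_in_arrows[OF c(2) xz(1)]])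
        (use mek xz(2,3) Comp_assoc[OF c(2) xz(1) pr_arrows(1)]
          Comp_assoc[OF c(2) xz(1) pr_arrows(2)] in simp_all)
    moreover have "pairing C X x z \<in> arrows C A (Cod C m)"
      using xz(1) mm(2) by simp
    ultimately show ?L
      using regular_epi_diagonal[OF c mm(1) ek] by metis
  qed
qed

lemma rel_comp_inhabited:
  assumes R: "R \<in> relations C X" and S: "S \<in> relations C X"
  shows "\<exists>m. m \<in> rel_comp C X S R"
proof -
  obtain r s where r: "r \<in> R" and s: "s \<in> S"
    using relationsD(1)[OF R] relationsD(1)[OF S] by blast
  note rA = relationsD(3)[OF R r] and sA = relationsD(3)[OF S s]
  obtain u v where pb: "is_pullback C (pr2 C X \<cdot> r) (pr1 C X \<cdot> s) u v"
    using ex_pullback[OF Comp_in_arrows[OF rA pr_arrows(2)] Comp_in_arrows[OF sA pr_arrows(1)]] by blast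
  then have u: "u \<in> arrows C (Dom C u) (Dom C r)" and v: "v \<in> arrows C (Dom C u) (Dom C s)"
    using rA sA by (auto simp: is_pullback_def arrow_simps pr_Arr)
  have "pr1 C X \<cdot> r \<cdot> u \<in> arrows C (Dom C u) X" "pr2 C X \<cdot> s \<cdot> v \<in> arrows C (Dom C u) X"
    using Comp_in_arrows[OF u Comp_in_arrows[OF rA pr_arrows(1)]]
      Comp_in_arrows[OF v Comp_in_arrows[OF sA pr_arrows(2)]] by simp_all
  from ex_image[OF pairing(1)[OF this]] obtain m e where
    "monic C m" "Cod C m = sq C X" "regular_epi C e" "e \<in> arrows C (Dom C u) (Dom C m)"
    "m \<cdot> e = pairing C X (pr1 C X \<cdot> r \<cdot> u) (pr2 C X \<cdot> s \<cdot> v)" .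
  then show ?thesis
    using r s pb unfolding rel_comp_def by blast
qed

text \<open>By the previous characterization, all members of \<open>rel_comp C X S R\<close> admit the same pairs of
  generalized elements, whatever representatives, pullback and factorization they come from;
  so they are isomorphic. Conversely, transporting the factorization along an isomorphism shows
  that the whole class is reached.\<close>

lemma rel_comp_relations:
  assumes R: "R \<in> relations C X" and S: "S \<in> relations C X"
  shows "rel_comp C X S R \<in> relations C X"
  unfolding relations_def
proof -
  have mono: "monic C m" "Cod C m = sq C X" "m \<in> arrows C (Dom C m) (sq C X)"
    if "m \<in> rel_comp C X S R" for m
    using that monic_Arr by (auto simp: rel_comp_def arrows_def)
  obtain m0 where m0: "m0 \<in> rel_comp C X S R"
    using rel_comp_inhabited[OF R S] by blast
  show "rel_comp C X S R \<in> subobjects C (sq C X)"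
  proof (rule subobjectsI[OF m0])
    show "monic C m \<and> Cod C m = sq C X" if "m \<in> rel_comp C X S R" for m
      using mono[OF that] by blast
    show "\<exists>h\<in>arrows C (Dom C m) (Dom C n). n \<cdot> h = m"
      if m: "m \<in> rel_comp C X S R" and n: "n \<in> rel_comp C X S R" for m n
    proof -
      note mA = mono(3)[OF m]
      note p = Comp_in_arrows[OF mA pr_arrows(1)] Comp_in_arrows[OF mA pr_arrows(2)]
      have eq: "pairing C X (pr1 C X \<cdot> m) (pr2 C X \<cdot> m) = m"
        by (rule square_eqI[OF pairing(1)[OF p] mA]) (simp_all add: pairing[OF p])
      have "m \<cdot> Id C (Dom C m) = m" "Id C (Dom C m) \<in> arrows C (Dom C m) (Dom C m)"
        using mA by (simp_all add: arrow_simps)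
      then have "\<exists>h\<in>arrows C (Dom C m) (Dom C m). m \<cdot> h = pairing C X (pr1 C X \<cdot> m) (pr2 C X \<cdot> m)"
        unfolding eq by blast
      then have "\<exists>h\<in>arrows C (Dom C m) (Dom C n). n \<cdot> h = pairing C X (pr1 C X \<cdot> m) (pr2 C X \<cdot> m)"
        unfolding rel_comp_factor_iff[OF R S m p] rel_comp_factor_iff[OF R S n p] .
      then show ?thesis unfolding eq .
    qed
    show "n \<in> rel_comp C X S R"
      if m: "m \<in> rel_comp C X S R" and mn: "(m, n) \<in> subobject_equiv C (sq C X)" for m n
    proof -
      obtain h where h: "h \<in> arrows C (Dom C m) (Dom C n)" "isomorphism C h" "n \<cdot> h = m"
        and n: "monic C n" "Cod C n = sq C X"
        using mn by (auto simp: subobject_equiv_def)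
      obtain r s u v e where rs: "r \<in> R" "s \<in> S"
        "is_pullback C (pr2 C X \<cdot> r) (pr1 C X \<cdot> s) u v"
        and e: "regular_epi C e" "e \<in> arrows C (Dom C u) (Dom C m)"
        and me: "m \<cdot> e = pairing C X (pr1 C X \<cdot> r \<cdot> u) (pr2 C X \<cdot> s \<cdot> v)"
        using m by (auto simp: rel_comp_def)
      have nA: "n \<in> arrows C (Dom C n) (sq C X)" using n monic_Arr by (simp add: arrows_def)
      have "regular_epi C (h \<cdot> e)"
        using regular_epi_iso[OF e(1) h(2)] h(1) e(2) by (simp add: arrows_def)
      moreover have "n \<cdot> (h \<cdot> e) = m \<cdot> e"
        using Comp_assoc[OF e(2) h(1) nA] h(3) by simp
      ultimately show ?thesis
        using rs n me Comp_in_arrows[OF e(2) h(1)] unfolding rel_comp_def by force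
    qed
  qed
qed

lemma related_rel_comp:
  assumes R: "R \<in> relations C X" and S: "S \<in> relations C X"
    and x: "x \<in> arrows C A X" and z: "z \<in> arrows C A X"
  shows "related C X A (rel_comp C X S R) x z \<longleftrightarrow>
    (\<exists>B c y. regular_epi C c \<and> c \<in> arrows C B A \<and> related C X B R (x \<cdot> c) y \<and> related C X B S y (z \<cdot> c))"
proof -
  obtain m where m: "m \<in> rel_comp C X S R"
    using rel_comp_inhabited[OF R S] by blast
  show ?thesis
    using related_iff[OF rel_comp_relations[OF R S] m x z] rel_comp_factor_iff[OF R S m x z] by simp
qed

lemma regular_epi_Id:
  assumes "A \<in> Obj C"
  shows "regular_epi C (Id C A)"
proof -
  have i: "Id C A \<in> arrows C A A" using Id_in_arrows[OF assms] .
  have "\<exists>!h. h \<in> arrows C A Z \<and> h \<cdot> Id C A = k" if "k \<in> arrows C A Z" for k Z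
    using that Comp_Id_right by metis
  then have "is_coequalizer C (Id C A) (Id C A) (Id C A)"
    using i by (auto simp: is_coequalizer_def arrows_def)
  then show ?thesis by (auto simp: regular_epi_def)
qed

lemma related_rel_compI:
  assumes R: "R \<in> relations C X" and S: "S \<in> relations C X"
    and xy: "related C X A R x y" and yz: "related C X A S y z"
  shows "related C X A (rel_comp C X S R) x z"
proof -
  note x = related_arrows(1)[OF R xy] and z = related_arrows(2)[OF S yz]
  have A: "A \<in> Obj C" using x Dom_in_Obj by (auto simp: arrows_def)
  have "related C X A R (x \<cdot> Id C A) y" "related C X A S y (z \<cdot> Id C A)"
    using xy yz Comp_Id_right[OF x] Comp_Id_right[OF z] by simp_all
  then show ?thesis
    using related_rel_comp[OF R S x z] regular_epi_Id[OF A] Id_in_arrows[OF A] by blast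
qed

text \<open>Since membership is local, inclusions of composites may be checked on strictly composable
  pairs, as for relations between sets.\<close>

lemma rel_comp_leI:
  assumes R: "R \<in> relations C X" and S: "S \<in> relations C X" and T: "T \<in> relations C X"
    and sub: "\<And>A x y z. \<lbrakk>related C X A R x y; related C X A S y z\<rbrakk> \<Longrightarrow> related C X A T x z"
  shows "subobject_le C (rel_comp C X S R) T"
proof (rule subobject_leI[OF rel_comp_relations[OF R S] T])
  fix A x z assume xz: "related C X A (rel_comp C X S R) x z"
  note x = related_arrows[OF rel_comp_relations[OF R S] xz]
  obtain B c y where c: "regular_epi C c" "c \<in> arrows C B A"
    "related C X B R (x \<cdot> c) y" "related C X B S y (z \<cdot> c)"
    using related_rel_comp[OF R S x] xz by blast
  show "related C X A T x z"
    using related_local[OF T c(1,2) x sub[OF c(3,4)]] .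
qed

lemma rel_comp_mono:
  assumes "R \<in> relations C X" "S \<in> relations C X" "R' \<in> relations C X" "S' \<in> relations C X"
    and "subobject_le C R R'" "subobject_le C S S'"
  shows "subobject_le C (rel_comp C X S R) (rel_comp C X S' R')"
  using assms by (intro rel_comp_leI rel_comp_relations) (auto intro: related_rel_compI subobject_leD)

text \<open>An element \<open>w\<close> between \<open>x\<close> and \<open>y\<close> exists only on a cover of the stage; the conclusion is drawn there
  and descends by locality.\<close>

lemma rel_comp_assoc_le:
  assumes R: "R \<in> relations C X" and S: "S \<in> relations C X" and T: "T \<in> relations C X"
  shows "subobject_le C (rel_comp C X T (rel_comp C X S R)) (rel_comp C X (rel_comp C X T S) R)"
proof (rule rel_comp_leI[OF rel_comp_relations[OF R S] T])
  note TS = rel_comp_relations[OF S T] and SR = rel_comp_relations[OF R S]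
  show TSR: "rel_comp C X (rel_comp C X T S) R \<in> relations C X"
    using rel_comp_relations[OF R TS] .
  fix A x y z
  assume xy: "related C X A (rel_comp C X S R) x y" and yz: "related C X A T y z"
  note x = related_arrows[OF SR xy] and z = related_arrows(2)[OF T yz]
  obtain B c w where c: "regular_epi C c" "c \<in> arrows C B A"
    "related C X B R (x \<cdot> c) w" "related C X B S w (y \<cdot> c)"
    using related_rel_comp[OF R S x] xy by blast
  have "related C X B (rel_comp C X T S) w (z \<cdot> c)"
    using related_rel_compI[OF S T c(4) related_reindex[OF T yz c(2)]] .
  then show "related C X A (rel_comp C X (rel_comp C X T S) R) x z"
    using related_local[OF TSR c(1,2) x(1) z] related_rel_compI[OF R TS c(3)] by blast
qed

lemma rel_op_mono:
  assumes "R \<in> relations C X" "S \<in> relations C X" "subobject_le C R S"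
  shows "subobject_le C (rel_op C X R) (rel_op C X S)"
  using assms subobject_leD[OF assms(3,1,2)]
  by (auto intro!: subobject_leI rel_op_relations simp: related_rel_op)

lemma rel_op_le_iff:
  assumes "R \<in> relations C X" "S \<in> relations C X"
  shows "subobject_le C (rel_op C X R) S \<longleftrightarrow> subobject_le C R (rel_op C X S)"
  using assms by (auto simp: subobject_le_iff_related rel_op_relations related_rel_op)

lemma rel_op_rel_comp_le:
  assumes R: "R \<in> relations C X" and S: "S \<in> relations C X"
  shows "subobject_le C (rel_op C X (rel_comp C X S R)) (rel_comp C X (rel_op C X R) (rel_op C X S))"
  unfolding rel_op_le_iff[OF rel_comp_relations[OF R S]
    rel_comp_relations[OF rel_op_relations[OF S] rel_op_relations[OF R]]]
  using R S by (intro rel_comp_leI)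
    (auto simp: related_rel_op rel_op_relations rel_comp_relations intro!: related_rel_compI)

lemma rel_comp_le_rel_op:
  assumes R: "R \<in> relations C X" and S: "S \<in> relations C X"
  shows "subobject_le C (rel_comp C X (rel_op C X R) (rel_op C X S)) (rel_op C X (rel_comp C X S R))"
  using R S by (intro rel_comp_leI)
    (auto simp: related_rel_op rel_op_relations rel_comp_relations intro!: related_rel_compI)

lemma reflexive_rel_diag: "reflexive_rel C X (rel_diag C X)"
  by (simp add: reflexive_rel_iff related_rel_diag rel_diag_relations)

lemma reflexive_rel_op: "reflexive_rel C X R \<Longrightarrow> reflexive_rel C X (rel_op C X R)"
  by (simp add: reflexive_rel_iff related_rel_op rel_op_relations)

lemma rel_comp_upper:
  assumes R: "reflexive_rel C X R" and S: "reflexive_rel C X S"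
  shows "subobject_le C R (rel_comp C X S R)" "subobject_le C S (rel_comp C X S R)"
proof -
  note r = reflexive_relations[OF R] and s = reflexive_relations[OF S]
  show "subobject_le C R (rel_comp C X S R)"
  proof (rule subobject_leI[OF r rel_comp_relations[OF r s]])
    fix A x y assume xy: "related C X A R x y"
    then have "related C X A S y y"
      using S related_arrows[OF r xy] by (simp add: reflexive_rel_iff)
    then show "related C X A (rel_comp C X S R) x y"
      using related_rel_compI[OF r s xy] by blast
  qed
  show "subobject_le C S (rel_comp C X S R)"
  proof (rule subobject_leI[OF s rel_comp_relations[OF r s]])
    fix A x y assume xy: "related C X A S x y"
    then have "related C X A R x x"
      using R related_arrows[OF s xy] by (simp add: reflexive_rel_iff)
    then show "related C X A (rel_comp C X S R) x y"
      using related_rel_compI[OF r s _ xy] by blast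
  qed
qed

lemma reflexive_rel_comp:
  assumes R: "reflexive_rel C X R" and S: "reflexive_rel C X S"
  shows "reflexive_rel C X (rel_comp C X S R)"
  using rel_le_trans[OF _ rel_comp_upper(1)[OF R S] rel_diag_relations] R S rel_comp_relations
  by (simp add: reflexive_rel_def)

lemma rel_comp_diag_le:
  assumes R: "R \<in> relations C X"
  shows "subobject_le C (rel_comp C X R (rel_diag C X)) R" "subobject_le C (rel_comp C X (rel_diag C X) R) R"
  using R by (auto intro!: rel_comp_leI simp: rel_diag_relations related_rel_diag)

section \<open>Suprema of chains\<close>

context
  assumes sups: "has_chain_sups C" and stable: "chain_sups_stable C"
begin

lemma chain_sup_least:
  assumes "reflexive_chain C X R"
  shows "reflexive_rel C X (chain_sup C X R)"
    and "subobject_le C (R i) (chain_sup C X R)"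
    and "\<lbrakk>reflexive_rel C X U; \<And>i. subobject_le C (R i) U\<rbrakk> \<Longrightarrow> subobject_le C (chain_sup C X R) U"
proof -
  have "\<exists>W. least (reflexive_order C X) W (Upper (reflexive_order C X) (range R))"
    using sups X assms by (auto simp: has_chain_sups_def)
  from someI_ex[OF this]
  have "least (reflexive_order C X) (chain_sup C X R) (Upper (reflexive_order C X) (range R))"
    by (simp add: chain_sup_def sup_def)
  moreover have "reflexive_rel C X (R i)" for i
    using assms by (simp add: reflexive_chain_def)
  ultimately show "reflexive_rel C X (chain_sup C X R)" "subobject_le C (R i) (chain_sup C X R)"
    "\<lbrakk>reflexive_rel C X U; \<And>i. subobject_le C (R i) U\<rbrakk> \<Longrightarrow> subobject_le C (chain_sup C X R) U"
    by (auto simp: least_def Upper_def reflexive_order_def)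
qed

text \<open>Stability enters only through this rule and its mirror image below, for bounding a composite with
  a supremum.\<close>

lemma chain_sup_comp_right_le:
  assumes R: "reflexive_chain C X R" and T: "reflexive_rel C X T" and U: "reflexive_rel C X U"
    and le: "\<And>i. subobject_le C (rel_comp C X (R i) T) U"
  shows "subobject_le C (rel_comp C X (chain_sup C X R) T) U"
proof -
  have r: "reflexive_rel C X (R i)" "subobject_le C (R i) (R (Suc i))" for i
    using R by (simp_all add: reflexive_chain_def)
  have "reflexive_chain C X (\<lambda>i. rel_comp C X (R i) T)"
    using r T reflexive_rel_comp rel_comp_mono reflexive_relations rel_le_refl
    by (simp add: reflexive_chain_def)
  then have "subobject_le C (chain_sup C X (\<lambda>i. rel_comp C X (R i) T)) U"
    using chain_sup_least(3) U le by blast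
  then show ?thesis
    using stable X R T by (simp add: chain_sups_stable_def)
qed

text \<open>Stability is assumed for composition on one side only. The other side follows because passing
  to the opposite relation is an order isomorphism that reverses composition.\<close>

lemma chain_sup_comp_left_le:
  assumes R: "reflexive_chain C X R" and T: "reflexive_rel C X T" and U: "reflexive_rel C X U"
    and le: "\<And>i. subobject_le C (rel_comp C X T (R i)) U"
  shows "subobject_le C (rel_comp C X T (chain_sup C X R)) U"
proof -
  let ?op = "rel_op C X"
  let ?W = "chain_sup C X R" and ?W' = "chain_sup C X (\<lambda>i. ?op (R i))"
  have r: "reflexive_rel C X (R i)" "subobject_le C (R i) (R (Suc i))" for i
    using R by (simp_all add: reflexive_chain_def)
  have op: "reflexive_chain C X (\<lambda>i. ?op (R i))"
    using r reflexive_rel_op rel_op_mono reflexive_relations by (simp add: reflexive_chain_def)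
  note W = chain_sup_least(1)[OF R] and W' = chain_sup_least(1)[OF op]
  note rels = W[THEN reflexive_relations] W'[THEN reflexive_relations] T[THEN reflexive_relations]
    U[THEN reflexive_relations] r(1)[THEN reflexive_relations]
  have "subobject_le C (R i) (?op ?W')" for i
    using chain_sup_least(2)[OF op, of i] rel_op_le_iff[OF rels(5,2)] by simp
  then have "subobject_le C ?W (?op ?W')"
    using chain_sup_least(3)[OF R reflexive_rel_op[OF W']] by blast
  then have "subobject_le C (?op ?W) ?W'"
    using rel_op_le_iff[OF rels(1,2)] by simp
  then have 1: "subobject_le C (rel_comp C X (?op ?W) (?op T)) (rel_comp C X ?W' (?op T))"
    using rels by (intro rel_comp_mono rel_op_relations rel_le_refl)
  have "subobject_le C (rel_comp C X (?op (R i)) (?op T)) (?op U)" for i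
    using rel_le_trans[OF rel_comp_le_rel_op[OF rels(5,3)] rel_op_mono[OF _ _ le]] rels
    by (simp add: rel_op_relations rel_comp_relations)
  then have 2: "subobject_le C (rel_comp C X ?W' (?op T)) (?op U)"
    using chain_sup_comp_right_le[OF op reflexive_rel_op[OF T] reflexive_rel_op[OF U]] by blast
  have "subobject_le C (?op (rel_comp C X T ?W)) (?op U)"
    using rel_le_trans[OF rel_op_rel_comp_le[OF rels(1,3)] rel_le_trans[OF 1 2]] rels
    by (simp add: rel_op_relations rel_comp_relations)
  then show ?thesis
    using rels by (simp add: subobject_le_iff_related related_rel_op rel_op_relations rel_comp_relations)
qed

section \<open>Alternating products\<close>

context
  fixes R S :: "'b set"
  assumes R: "reflexive_rel C X R" and S: "reflexive_rel C X S"
begin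

lemma reflexive_alternating: "reflexive_rel C X (alternating C X R S n)"
proof (induction n)
  case 0
  show ?case by (simp add: reflexive_rel_diag)
next
  case (Suc n)
  then show ?case by (cases n) (simp_all add: R S reflexive_rel_comp)
qed

lemmas alternating_relations = reflexive_relations[OF reflexive_alternating]

lemma reflexive_chain_alternating: "reflexive_chain C X (alternating C X R S)"
proof -
  have "subobject_le C (alternating C X R S i) (alternating C X R S (Suc i))" for i
    using R S rel_comp_upper(2)[OF _ reflexive_alternating[of i]]
    by (cases i) (simp_all add: reflexive_rel_def)
  then show ?thesis
    by (simp add: reflexive_chain_def reflexive_alternating)
qed

text \<open>When \<open>n\<close> is even, \<open>(R, S)\<^sub>n\<close> is the diagonal or ends with \<open>S\<close>, so \<open>(R, S)\<^sub>m\<close> continues the alternation.\<close>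

lemma alternating_comp_even_le:
  assumes "even n"
  shows "subobject_le C (rel_comp C X (alternating C X R S n) (alternating C X R S m))
    (alternating C X R S (n + m))"
proof (induction m)
  case 0
  show ?case using rel_comp_diag_le(1)[OF alternating_relations] by simp
next
  case (Suc k)
  show ?case
  proof (cases k)
    case 0
    show ?thesis
    proof (cases n)
      case 0
      with \<open>k = 0\<close> show ?thesis
        using rel_comp_diag_le(2)[OF reflexive_relations[OF R]] by simp
    next
      case (Suc l)
      with \<open>k = 0\<close> assms show ?thesis
        using rel_le_refl[OF alternating_relations[of "Suc n"]] by simp
    qed
  next
    case k: (Suc j)
    let ?Q = "if even j then S else R"
    have Q: "?Q \<in> relations C X" using R S by (simp add: reflexive_relations)
    note A = alternating_relations
    have "subobject_le C (rel_comp C X (alternating C X R S n) (rel_comp C X (alternating C X R S k) ?Q))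
        (rel_comp C X (rel_comp C X (alternating C X R S n) (alternating C X R S k)) ?Q)"
      by (rule rel_comp_assoc_le[OF Q A A])
    moreover have "subobject_le C
        (rel_comp C X (rel_comp C X (alternating C X R S n) (alternating C X R S k)) ?Q)
        (rel_comp C X (alternating C X R S (n + k)) ?Q)"
      by (intro rel_comp_mono rel_comp_relations rel_le_refl Q A Suc.IH)
    ultimately have "subobject_le C
        (rel_comp C X (alternating C X R S n) (rel_comp C X (alternating C X R S k) ?Q))
        (rel_comp C X (alternating C X R S (n + k)) ?Q)"
      by (rule rel_le_trans) (intro rel_comp_relations Q A)+
    then show ?thesis using assms k by simp
  qed
qed

text \<open>When \<open>n\<close> is odd, the two adjacent factors \<open>R\<close> are separated by inserting \<open>S\<close>, which is harmless
  since \<open>S\<close> is reflexive.\<close>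

lemma alternating_comp_le:
  "subobject_le C (rel_comp C X (alternating C X R S n) (alternating C X R S m))
    (alternating C X R S (Suc n + m))"
proof -
  note A = alternating_relations and c = reflexive_chain_alternating[unfolded reflexive_chain_def]
  have step: "subobject_le C (alternating C X R S i) (alternating C X R S (Suc i))" for i
    using c by blast
  show ?thesis
  proof (cases "even n")
    case True
    show ?thesis
      using rel_le_trans[OF alternating_comp_even_le[OF True] step rel_comp_relations[OF A A] A A]
      by simp
  next
    case False
    \<comment> \<open>Passing from \<open>n\<close> to \<open>Suc n\<close> appends the separating factor \<open>S\<close>.\<close>
    have "subobject_le C (rel_comp C X (alternating C X R S n) (alternating C X R S m))
        (rel_comp C X (alternating C X R S (Suc n)) (alternating C X R S m))"
      by (intro rel_comp_mono rel_le_refl A step)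
    then show ?thesis
      by (rule rel_le_trans[OF _ alternating_comp_even_le])
        (use False in \<open>simp_all del: alternating.simps add: A rel_comp_relations\<close>)
  qed
qed

lemma preorder_alternating_sup: "preorder_rel C X (chain_sup C X (alternating C X R S))"
  (is "preorder_rel C X ?W")
proof -
  note chain = reflexive_chain_alternating
  note W = chain_sup_least(1)[OF chain]
  have "subobject_le C (rel_comp C X (alternating C X R S n) (alternating C X R S m)) ?W" for n m
    using rel_le_trans[OF alternating_comp_le chain_sup_least(2)[OF chain]] reflexive_relations[OF W]
    by (simp add: rel_comp_relations alternating_relations)
  then have "subobject_le C (rel_comp C X (alternating C X R S n) ?W) ?W" for n
    using chain_sup_comp_left_le[OF chain reflexive_alternating W] by blast
  then have "subobject_le C (rel_comp C X ?W ?W) ?W"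
    using chain_sup_comp_right_le[OF chain W W] by blast
  then show ?thesis
    using W by (simp add: preorder_rel_def transitive_rel_def reflexive_relations)
qed

text \<open>The supremum contains \<open>R\<close> and \<open>S\<close>, hence, by transitivity, every product of them in either
  order. The opposite of \<open>(R, S)\<^sub>n\<close> is such a product when \<open>R\<close> and \<open>S\<close> are symmetric.\<close>

lemma symmetric_alternating_sup:
  assumes "symmetric_rel C X R" "symmetric_rel C X S"
  shows "symmetric_rel C X (chain_sup C X (alternating C X R S))" (is "symmetric_rel C X ?W")
proof -
  let ?A = "alternating C X R S" and ?op = "rel_op C X"
  note chain = reflexive_chain_alternating
  note W = chain_sup_least(1)[OF chain]
  note rels = reflexive_relations[OF R] reflexive_relations[OF S] reflexive_relations[OF W]
  have trans: "subobject_le C (rel_comp C X ?W ?W) ?W"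
    using preorder_alternating_sup by (simp add: preorder_rel_def transitive_rel_def)
  have RW: "subobject_le C R ?W"
    using chain_sup_least(2)[OF chain, of 1] by simp
  have "subobject_le C (?A 2) ?W"
    by (rule chain_sup_least(2)[OF chain])
  then have "subobject_le C (rel_comp C X R S) ?W"
    by (simp add: numeral_2_eq_2)
  then have SW: "subobject_le C S ?W"
    using rel_le_trans[OF rel_comp_upper(1)[OF S R]] rels rel_comp_relations by blast
  have Rop: "subobject_le C (?op R) ?W" and Sop: "subobject_le C (?op S) ?W"
    using assms rel_le_trans[OF _ RW] rel_le_trans[OF _ SW] rels rel_op_relations
    by (simp_all add: symmetric_rel_def)
  have "subobject_le C (?op (?A n)) ?W" for n
  proof (induction n)
    case 0
    have "subobject_le C (?op (rel_diag C X)) (rel_diag C X)"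
      by (intro subobject_leI rel_op_relations rel_diag_relations)
        (auto simp: related_rel_op rel_diag_relations related_rel_diag)
    then show ?case
      using rel_le_trans[OF _ chain_sup_least(2)[OF chain, of 0]] rels rel_op_relations
        rel_diag_relations by simp
  next
    case (Suc k)
    show ?case
    proof (cases k)
      case 0
      then show ?thesis using Rop by simp
    next
      case k: (Suc j)
      let ?Q = "if even j then S else R"
      have Q: "?Q \<in> relations C X" "subobject_le C (?op ?Q) ?W"
        using rels Rop Sop by simp_all
      note A = alternating_relations[of k]
      have "subobject_le C (?op (rel_comp C X (?A k) ?Q)) (rel_comp C X (?op ?Q) (?op (?A k)))"
        by (rule rel_op_rel_comp_le[OF Q(1) A])
      moreover have "subobject_le C (rel_comp C X (?op ?Q) (?op (?A k))) (rel_comp C X ?W ?W)"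
        by (intro rel_comp_mono rel_op_relations Q A rels(3) Suc.IH)
      ultimately have "subobject_le C (?op (rel_comp C X (?A k) ?Q)) (rel_comp C X ?W ?W)"
        by (rule rel_le_trans) (intro rel_comp_relations rel_op_relations Q(1) A rels(3))+
      then have "subobject_le C (?op (rel_comp C X (?A k) ?Q)) ?W"
        by (rule rel_le_trans[OF _ trans])
          (intro rel_comp_relations rel_op_relations Q(1) A rels(3))+
      then show ?thesis using k by simp
    qed
  qed
  then have "subobject_le C (?A n) (?op ?W)" for n
    using rel_op_le_iff[OF alternating_relations rels(3)] by blast
  then have "subobject_le C ?W (?op ?W)"
    using chain_sup_least(3)[OF chain reflexive_rel_op[OF W]] by blast
  then have "subobject_le C (?op ?W) ?W"
    using rel_op_le_iff[OF rels(3) rels(3)] by blast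
  then show ?thesis
    using rels(3) by (simp add: symmetric_rel_def)
qed

end

end

end

end

theorem theorem3p1:
  fixes C :: "('o, 'm) category" and X :: 'o and R S :: "'m set"
  assumes "regular_category C"
    and "has_chain_sups C"
    and "chain_sups_stable C"
    and "X \<in> Obj C"
    and "reflexive_rel C X R"
    and "reflexive_rel C X S"
  shows "preorder_rel C X (chain_sup C X (alternating C X R S)) \<and>
    (symmetric_rel C X R \<and> symmetric_rel C X S \<longrightarrow>
      equivalence_rel C X (chain_sup C X (alternating C X R S)))"
proof -
  interpret regular_category C by (rule assms(1))
  show ?thesis
    using preorder_alternating_sup[OF assms(4,2,3,5,6)] symmetric_alternating_sup[OF assms(4,2,3,5,6)]
    by (simp add: equivalence_rel_def)
qed

end
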